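(* Let $d\ge1$, $t\ge1$ be integers, $\epsilon\in(0,1)$, and let $\mu_t$ be a finite Borel measure on $\mathbb S^d$ satisfying the Marcinkiewicz–Zygmund inequalities of order $t$ with constants $0<a\le A$: \[ a\|f\|_{L^2(\mathbb S^d)}^2\le\int_{\mathbb S^d}|f|^2\,d\mu_t\le A\|f\|_{L^2(\mathbb S^d)}^2\quad\text{for all }f\in\Pi_t . \] Define \[ V_d=\frac{A/a}{1-\epsilon}\,\pi\,M_d\,d^2\,2^{\frac d2+6}\Big(\frac{\sqrt d}{e}\Big)^d,\qquad M_d=\frac{2e}{\pi}\Big(2+\sqrt{\tfrac{d^2}{2}-d+1}\Big). \] Then for every $R$ with $V_d/t\le R\le\pi$ and every $z\in\mathbb S^d$, \[ \mu_t\big(B_R(z)\big)\ge\frac{a\,\epsilon}{\dim\Pi_t}. \]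
   Context: $\mathbb S^d\subset\mathbb R^{d+1}$ is the unit sphere with normalized surface measure (total mass $1$), and $L^2$ norms are with respect to it. $B_R(z)=\{y\in\mathbb S^d:z\cdot y\ge\cos R\}$. $\Pi_t$ is the space of restrictions to $\mathbb S^d$ of polynomials in $d+1$ variables of degree at most $t$, $\dim\Pi_t=\binom{d+t}{t}+\binom{d+t-1}{t-1}$. *)

theory Defs
  imports "HOL-Analysis.Analysis"
begin

text \<open>Points of R^(d+1) are modelled as real^'n with CARD('n) = d+1.
  The unit sphere S^d is sphere 0 1.\<close>

text \<open>Normalized surface measure on the unit sphere, defined as the cone measure:
  sigma(A) = Lebesgue measure of the cone {r x. 0 < r <= 1, x in A} divided by the
  volume of the unit ball (total mass 1).\<close>
definition sphere_measure :: "(real ^ 'n) measure" where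
  "sphere_measure =
     measure_of (sphere 0 1) (sets (restrict_space borel (sphere 0 1)))
       (\<lambda>A. emeasure lborel {r *\<^sub>R x | r x. r \<in> {0<..1} \<and> x \<in> A}
              / emeasure lborel (ball (0::real ^ 'n) 1))"

definition monomial_fun :: "('n::finite \<Rightarrow> nat) \<Rightarrow> real ^ 'n \<Rightarrow> real" where
  "monomial_fun \<alpha> x = (\<Prod>i\<in>UNIV. (x $ i) ^ (\<alpha> i))"

text \<open>Pi_t: (real) polynomial functions in d+1 variables of total degree at most t
  (only their restrictions to the sphere matter below).\<close>
definition poly_space :: "nat \<Rightarrow> (real ^ 'n::finite \<Rightarrow> real) set" where
  "poly_space t = {f. \<exists>c. \<forall>x. f x =
      (\<Sum>\<alpha>\<in>{\<alpha>::'n \<Rightarrow> nat. sum \<alpha> UNIV \<le> t}. c \<alpha> * monomial_fun \<alpha> x)}"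

definition dim_Pi :: "nat \<Rightarrow> nat \<Rightarrow> nat" where
  "dim_Pi d t = (d + t choose t) + (d + t - 1 choose (t - 1))"

definition cap :: "real ^ 'n \<Rightarrow> real \<Rightarrow> (real ^ 'n) set" where
  "cap z R = {y \<in> sphere 0 1. z \<bullet> y \<ge> cos R}"

definition M_const :: "nat \<Rightarrow> real" where
  "M_const d = 2 * exp 1 / pi * (2 + sqrt (real d ^ 2 / 2 - real d + 1))"

definition V_const :: "nat \<Rightarrow> real \<Rightarrow> real \<Rightarrow> real \<Rightarrow> real" where
  "V_const d a A \<epsilon> = (A / a) / (1 - \<epsilon>) * pi * M_const d * real d ^ 2
      * 2 powr (real d / 2 + 6) * (sqrt (real d) / exp 1) ^ d"

end

theory Submission
  imports Defs "HOL-Computational_Algebra.Polynomial"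
begin

text \<open>Test the inequalities on the zonal polynomial \<open>f(y) = q(z \<cdot> y)\<close> of degree \<open>t - 1\<close>, where
  \<open>q = (1 + x) P''\<close> and \<open>P\<close> is the Gegenbauer polynomial of degree \<open>t\<close>. Rotation invariance of the
  sphere measure gives \<open>\<integral> (1 - x\<^sup>2) p' = d \<integral> x p\<close> for zonal integrals, and together with the
  differential equation of \<open>P\<close> this yields exactly
  \<open>\<integral> (1 - z \<cdot> y) f\<^sup>2 = d (d + 4) / (4 t (t + d - 1) + d\<^sup>2 - 2 d) \<integral> f\<^sup>2\<close>.
  Since \<open>1 - z \<cdot> y = |y - z|\<^sup>2 / 2\<close>, the upper inequality applied to \<open>(y\<^sub>i - z\<^sub>i) f \<in> \<Pi>\<^sub>t\<close> bounds the
  \<open>\<mu>\<close>-mass of \<open>f\<^sup>2\<close> outside the cap by \<open>(1 - \<epsilon>) a \<integral> f\<^sup>2\<close>, so by the lower inequality the cap carries at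
  least \<open>\<epsilon> a \<integral> f\<^sup>2\<close>. On the cap, \<open>f\<^sup>2 \<le> dim \<Pi>\<^sub>t \<integral> f\<^sup>2\<close> by the reproducing kernel of \<open>\<Pi>\<^sub>t\<close>.\<close>

section \<open>Orthogonal invariance of Lebesgue measure\<close>

text \<open>The hypotheses control only integrals of squares of elements of \<open>Pi_t\<close>, so
  the weight \<open>1 - z . y\<close> must enter as a sum of squares of linear forms; hence one
  degree is kept free. The choice of \<open>q\<close>: at an angle \<open>r\<close> from the pole
  well beyond \<open>1/t\<close>, the amplitude of \<open>P\<close> behaves like
  \<open>r^(-(d-1)/2)\<close>, each derivative contributes a further factor \<open>1/r\<close>, and
  the zonal density has size \<open>r^(d-1)\<close>. Only from the second derivative on is the
  second moment in \<open>r\<close> of the square governed by the scale \<open>1/t\<close>; with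
  \<open>P'\<close> the ratio would be of order \<open>1/t\<close> instead of \<open>1/t^2\<close>.
  The even function \<open>P''^2\<close> peaks at \<open>-z\<close> as well, and the factor
  \<open>1 + x\<close> removes that peak. After expansion the odd parts integrate to zero, so two
  moments determine both integrals. The zonal density is never computed: all identities are derived
  from rotation invariance, and that from Lebesgue measure, since the sphere measure is a cone
  measure. A ratio of order \<open>1/t^2\<close> against \<open>1 - cos R\<close>, which is at least
  of order \<open>R^2\<close>, is what makes radii of order \<open>1/t\<close> sufficient.\<close>

lemma nn_integral_lborel_shift:
  fixes f :: "'a::euclidean_space \<Rightarrow> ennreal"
  assumes [measurable]: "f \<in> borel_measurable borel"
  shows "(\<integral>\<^sup>+x. f (x + c) \<partial>lborel) = (\<integral>\<^sup>+x. f x \<partial>lborel)"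
proof -
  have "lborel = distr lborel borel (\<lambda>x. c + 1 *\<^sub>R x :: 'a)"
    using lborel_affine[of 1 c] by (simp add: density_1)
  then have "(\<integral>\<^sup>+x. f x \<partial>lborel) = (\<integral>\<^sup>+x. f x \<partial>distr lborel borel (\<lambda>x. c + 1 *\<^sub>R x :: 'a))"
    by simp
  also have "\<dots> = (\<integral>\<^sup>+x. f (c + 1 *\<^sub>R x) \<partial>lborel)"
    by (rule nn_integral_distr) auto
  finally show ?thesis
    by (simp add: add.commute)
qed

lemma nn_integral_lborel_reflect:
  fixes f :: "'a::euclidean_space \<Rightarrow> ennreal"
  assumes [measurable]: "f \<in> borel_measurable borel"
  shows "(\<integral>\<^sup>+x. f (c - x) \<partial>lborel) = (\<integral>\<^sup>+x. f x \<partial>lborel)"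
proof -
  have "lborel = distr lborel borel (\<lambda>x. c + (-1) *\<^sub>R x :: 'a)"
    using lborel_affine[of "-1" c] by (simp add: density_1)
  then have "(\<integral>\<^sup>+x. f x \<partial>lborel) = (\<integral>\<^sup>+x. f x \<partial>distr lborel borel (\<lambda>x. c + (-1) *\<^sub>R x :: 'a))"
    by simp
  also have "\<dots> = (\<integral>\<^sup>+x. f (c + (-1) *\<^sub>R x) \<partial>lborel)"
    by (rule nn_integral_distr) auto
  finally show ?thesis
    by simp
qed

lemma emeasure_lborel_open_pos:
  fixes S :: "'a::euclidean_space set"
  assumes "open S" "S \<noteq> {}"
  shows "emeasure lborel S > 0"
proof (rule ccontr)
  assume "\<not> emeasure lborel S > 0"
  then have "S \<in> null_sets lborel"
    using assms by (auto simp: null_sets_def)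
  then have "negligible S"
    by (simp add: negligible_iff_null_sets null_sets_completionI)
  then show False
    using open_not_negligible[OF assms] by simp
qed

text \<open>As in the proof of uniqueness of Haar measure,
  evaluate \<open>\<integral>\<integral> 1\<^sub>A(x) 1\<^sub>B(T y - x) dx dy\<close> in both orders,
  with \<open>B\<close> the unit ball, which \<open>T\<close> preserves.\<close>

lemma emeasure_lborel_orthogonal_vimage:
  fixes T :: "'a::euclidean_space \<Rightarrow> 'a"
  assumes T: "orthogonal_transformation T" and A[measurable]: "A \<in> sets borel"
  shows "emeasure lborel (T -` A) = emeasure lborel A"
proof -
  have lin: "linear T" and bij: "bij T"
    using T by (auto simp: orthogonal_transformation_linear orthogonal_transformation_bij)
  have [measurable]: "T \<in> borel_measurable borel"
    by (intro borel_measurable_continuous_onI linear_continuous_on linear_conv_bounded_linear[THEN iffD1] lin)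
  define B where "B = ball (0::'a) 1"
  have [measurable]: "B \<in> sets borel" by (simp add: B_def)
  have TB: "T -` B = B"
    by (auto simp: B_def orthogonal_transformation_norm[OF T])
  have vimage: "(\<integral>\<^sup>+y. indicator S (T y - x) \<partial>lborel) = emeasure lborel (T -` S)"
    if [measurable]: "S \<in> sets borel" for S x
  proof -
    \<comment> \<open>Surjectivity turns the shift by \<open>x\<close> after \<open>T\<close> into a
      shift by \<open>u\<close> before it, so the integral over \<open>y\<close> does not depend on
      \<open>x\<close>.\<close>
    obtain u where u: "T u = - x"
      using bij by (metis bij_pointE)
    have "(\<integral>\<^sup>+y. indicator S (T y - x) \<partial>lborel) = (\<integral>\<^sup>+y. indicator S (T (y + u)) \<partial>lborel)"
      by (simp add: linear_add[OF lin] u)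
    also have "\<dots> = (\<integral>\<^sup>+y. indicator S (T y) \<partial>lborel)"
      by (rule nn_integral_lborel_shift[of "\<lambda>y. indicator S (T y)"]) measurable
    also have "\<dots> = (\<integral>\<^sup>+y. indicator (T -` S) y \<partial>lborel)"
      by (simp add: indicator_vimage)
    also have "\<dots> = emeasure lborel (T -` S)"
      using measurable_sets[of T borel borel S] by (intro nn_integral_indicator) auto
    finally show ?thesis .
  qed
  define I where "I = (\<integral>\<^sup>+x. \<integral>\<^sup>+y. indicator A x * indicator B (T y - x) \<partial>lborel \<partial>lborel)"
  have "I = (\<integral>\<^sup>+x. indicator A x * emeasure lborel B \<partial>lborel)"
    by (simp add: I_def nn_integral_cmult vimage TB)
  also have "\<dots> = emeasure lborel A * emeasure lborel B"
    by (simp add: nn_integral_multc)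
  finally have 1: "I = emeasure lborel A * emeasure lborel B" .
  have "I = (\<integral>\<^sup>+y. \<integral>\<^sup>+x. indicator A x * indicator B (T y - x) \<partial>lborel \<partial>lborel)"
    unfolding I_def by (rule lborel_pair.Fubini'[symmetric]) measurable
  also have "\<dots> = (\<integral>\<^sup>+y. \<integral>\<^sup>+x. indicator A (T y - x) * indicator B x \<partial>lborel \<partial>lborel)"
  proof (rule nn_integral_cong)
    fix y
    show "(\<integral>\<^sup>+x. indicator A x * indicator B (T y - x) \<partial>lborel)
        = (\<integral>\<^sup>+x. indicator A (T y - x) * indicator B x \<partial>lborel)"
      \<comment> \<open>The substitution of \<open>T y - x\<close> for \<open>x\<close> swaps the
        roles of \<open>A\<close> and \<open>B\<close>.\<close>
      using nn_integral_lborel_reflect[of "\<lambda>x. indicator A (T y - x) * indicator B x" "T y"]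
      by simp
  qed
  also have "\<dots> = (\<integral>\<^sup>+x. \<integral>\<^sup>+y. indicator A (T y - x) * indicator B x \<partial>lborel \<partial>lborel)"
    by (rule lborel_pair.Fubini') measurable
  also have "\<dots> = (\<integral>\<^sup>+x. emeasure lborel (T -` A) * indicator B x \<partial>lborel)"
    by (simp add: nn_integral_multc vimage)
  also have "\<dots> = emeasure lborel (T -` A) * emeasure lborel B"
    by (simp add: nn_integral_cmult)
  finally have "emeasure lborel (T -` A) * emeasure lborel B = emeasure lborel A * emeasure lborel B"
    using 1 by simp
  moreover have "emeasure lborel B \<noteq> 0" "emeasure lborel B \<noteq> top"
    using emeasure_lborel_open_pos[of "ball (0::'a) 1"] emeasure_lborel_ball_finite[of "0::'a" 1]
    by (auto simp: B_def less_top)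
  ultimately show ?thesis
    by (metis ennreal_mult_cancel_left mult.commute)
qed

section \<open>The sphere measure\<close>

text \<open>Preimages under \<open>sgn\<close> are measurable, preserve disjointness and are
  compatible with orthogonal maps, none of which is visible on the set comprehension of the
  definition.\<close>

lemma cone_eq_sgn_vimage:
  fixes A :: "'a::real_normed_vector set"
  assumes "A \<subseteq> sphere 0 1"
  shows "{r *\<^sub>R x | r x. r \<in> {0<..1} \<and> x \<in> A} = sgn -` A \<inter> (cball 0 1 - {0})"
proof (intro set_eqI iffI)
  fix v assume "v \<in> {r *\<^sub>R x | r x. r \<in> {0<..1} \<and> x \<in> A}"
  then obtain r x where v: "v = r *\<^sub>R x" and r: "0 < r" "r \<le> 1" and "x \<in> A" by auto
  moreover have "norm x = 1" using \<open>x \<in> A\<close> assms by auto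
  ultimately show "v \<in> sgn -` A \<inter> (cball 0 1 - {0})"
    by (auto simp: sgn_scaleR sgn_div_norm[of x])
next
  fix v assume v: "v \<in> sgn -` A \<inter> (cball 0 1 - {0})"
  then have "v = norm v *\<^sub>R sgn v" "norm v \<in> {0<..1}" "sgn v \<in> A"
    by (auto simp: sgn_div_norm)
  then show "v \<in> {r *\<^sub>R x | r x. r \<in> {0<..1} \<and> x \<in> A}"
    by blast
qed

lemma borel_measurable_sgn_vector [measurable]:
  "(sgn :: 'a::euclidean_space \<Rightarrow> 'a) \<in> borel_measurable borel"
  unfolding sgn_div_norm[abs_def] by measurable

lemma sets_restrict_space_sphere:
  "A \<in> sets (restrict_space borel (sphere (0::'a::euclidean_space) 1)) \<longleftrightarrow> A \<in> sets borel \<and> A \<subseteq> sphere 0 1"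
  by (subst sets_restrict_space_iff) auto

lemma sets_restrict_space_sphere_subset:
  "sets (restrict_space borel (sphere (0::'a::euclidean_space) 1)) \<subseteq> Pow (sphere 0 1)"
  using sets_restrict_space_sphere by blast

lemma space_sphere_measure [simp]: "space (sphere_measure :: (real ^ 'n) measure) = sphere 0 1"
  unfolding sphere_measure_def
  by (rule space_measure_of) (rule sets_restrict_space_sphere_subset)

lemma sets_sphere_measure:
  "sets (sphere_measure :: (real ^ 'n) measure) = sets (restrict_space borel (sphere 0 1))"
  unfolding sphere_measure_def
  using sets.sigma_sets_eq[of "restrict_space borel (sphere (0::real^'n) 1)"]
  by (subst sets_measure_of[OF sets_restrict_space_sphere_subset]) (simp add: space_restrict_space)

text \<open>\<open>measure_of\<close> takes the prescribed values only if they are positive and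
  countably additive; the content is the additivity of the volume of disjoint cones.\<close>

lemma emeasure_sphere_measure:
  fixes A :: "(real ^ 'n) set"
  assumes A: "A \<in> sets borel" "A \<subseteq> sphere 0 1"
  shows "emeasure sphere_measure A =
    emeasure lborel (sgn -` A \<inter> (cball 0 1 - {0})) / emeasure lborel (ball (0::real^'n) 1)"
proof -
  let ?C = "\<lambda>A. {r *\<^sub>R x | r x. r \<in> {0<..1} \<and> x \<in> A}"
  let ?S = "sets (sphere_measure :: (real ^ 'n) measure)"
  have C: "?C B = sgn -` B \<inter> (cball 0 1 - {0})" "?C B \<in> sets borel" if "B \<in> ?S" for B :: "(real^'n) set"
  proof -
    have B: "B \<in> sets borel" "B \<subseteq> sphere 0 1"
      using that by (simp_all add: sets_sphere_measure sets_restrict_space_sphere)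
    show "?C B = sgn -` B \<inter> (cball 0 1 - {0})"
      by (rule cone_eq_sgn_vimage) fact
    then show "?C B \<in> sets borel"
      using measurable_sets[OF borel_measurable_sgn_vector B(1)] by auto
  qed
  have "countably_additive ?S (\<lambda>A. emeasure lborel (?C A) / emeasure lborel (ball (0::real ^ 'n) 1))"
  proof (rule countably_additiveI)
    fix F :: "nat \<Rightarrow> (real^'n) set"
    assume F: "range F \<subseteq> ?S" "disjoint_family F" "\<Union> (range F) \<in> ?S"
    have "(\<Sum>i. emeasure lborel (?C (F i))) = emeasure lborel (\<Union>i. ?C (F i))"
    proof (rule suminf_emeasure)
      show "disjoint_family (\<lambda>i. ?C (F i))"
        using F C(1)[of "F _"] by (auto simp: disjoint_family_on_def)
    qed (use C(2) F in auto)
    also have "(\<Union>i. ?C (F i)) = ?C (\<Union> (range F))"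
      by blast
    finally show "(\<Sum>i. emeasure lborel (?C (F i)) / emeasure lborel (ball (0::real ^ 'n) 1)) =
        emeasure lborel (?C (\<Union> (range F))) / emeasure lborel (ball (0::real ^ 'n) 1)"
      by (simp add: divide_ennreal_def ennreal_suminf_multc)
  qed
  moreover have "positive ?S (\<lambda>A. emeasure lborel (?C A) / emeasure lborel (ball (0::real ^ 'n) 1))"
    by (simp add: positive_def)
  moreover have "A \<in> ?S"
    using A by (simp add: sets_sphere_measure sets_restrict_space_sphere)
  ultimately have "emeasure sphere_measure A = emeasure lborel (?C A) / emeasure lborel (ball (0::real ^ 'n) 1)"
    by (intro emeasure_measure_of[OF sphere_measure_def] sets_restrict_space_sphere_subset)
  then show ?thesis
    using cone_eq_sgn_vimage[OF A(2)] by simp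
qed

lemma emeasure_sphere_measure_sphere:
  "emeasure sphere_measure (sphere (0::real ^ 'n) 1) = 1"
proof -
  have "sgn -` sphere 0 1 \<inter> (cball 0 1 - {0::real^'n}) = cball 0 1 - {0}"
    by (auto simp: norm_sgn)
  moreover have "emeasure lborel (cball 0 1 - {0::real^'n}) = emeasure lborel (ball (0::real^'n) 1)"
  proof -
    have "emeasure lborel (cball 0 1 - {0::real^'n}) = emeasure lborel (cball (0::real^'n) 1)"
      by (rule emeasure_Diff_null_set) auto
    then show ?thesis
      by (simp add: emeasure_ball emeasure_cball)
  qed
  moreover have "emeasure lborel (ball (0::real^'n) 1) \<noteq> 0" "emeasure lborel (ball (0::real^'n) 1) \<noteq> top"
    using emeasure_lborel_open_pos[of "ball (0::real^'n) 1"] emeasure_lborel_ball_finite[of "0::real^'n" 1]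
    by (auto simp: less_top)
  ultimately show ?thesis
    by (subst emeasure_sphere_measure) (auto simp: less_top ennreal_divide_self)
qed

lemma finite_measure_sphere_measure: "finite_measure (sphere_measure :: (real ^ 'n) measure)"
  by (rule finite_measureI) (simp add: emeasure_sphere_measure_sphere)

lemma integral_sphere_measure_const [simp]:
  "(\<integral>x. (c::real) \<partial>(sphere_measure :: (real ^ 'n) measure)) = c"
  by (simp add: measure_def emeasure_sphere_measure_sphere)

lemma borel_measurable_on_sphere:
  fixes f :: "'a::euclidean_space \<Rightarrow> real"
  assumes "sets M = sets (restrict_space borel (sphere 0 1))" "continuous_on (sphere 0 1) f"
  shows "f \<in> borel_measurable M"
  unfolding measurable_cong_sets[OF assms(1) refl]
  by (rule borel_measurable_continuous_on_restrict) fact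

text \<open>A general \<open>M\<close> is allowed because both \<open>sphere_measure\<close> and the
  given measure on the sphere are instances.\<close>

lemma integrable_on_sphere:
  fixes f :: "'a::euclidean_space \<Rightarrow> real"
  assumes "finite_measure M" and M: "sets M = sets (restrict_space borel (sphere 0 1))"
    and f: "continuous_on (sphere 0 1) f"
  shows "integrable M f"
proof -
  interpret finite_measure M by fact
  have "space M = sphere 0 1"
    using sets_eq_imp_space_eq[OF M] by (simp add: space_restrict_space)
  moreover have "bounded (f ` sphere 0 1)"
    by (intro compact_imp_bounded compact_continuous_image f compact_sphere)
  then obtain B where "\<forall>x\<in>sphere 0 1. norm (f x) \<le> B"
    by (auto simp: bounded_iff)
  ultimately show ?thesis
    by (intro integrable_const_bound[where B = B] borel_measurable_on_sphere[OF M f] AE_I2) auto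
qed

lemma integrable_sphere_measure:
  fixes f :: "real ^ 'n \<Rightarrow> real"
  assumes "continuous_on (sphere 0 1) f"
  shows "integrable sphere_measure f"
  using finite_measure_sphere_measure sets_sphere_measure assms by (rule integrable_on_sphere)

lemma sgn_orthogonal_transformation:
  "orthogonal_transformation T \<Longrightarrow> sgn (T v) = T (sgn v)"
  by (simp add: sgn_div_norm orthogonal_transformation_norm orthogonal_transformation_scaleR)

text \<open>An orthogonal \<open>T\<close> commutes with \<open>sgn\<close> and preserves the unit
  ball, so the cone over a preimage is the preimage of the cone, and the Lebesgue case
  applies.\<close>

lemma integral_sphere_measure_orthogonal:
  fixes f :: "real ^ 'n \<Rightarrow> real" and T :: "real ^ 'n \<Rightarrow> real ^ 'n"
  assumes T: "orthogonal_transformation T" and f: "continuous_on (sphere 0 1) f"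
  shows "(\<integral>x. f (T x) \<partial>sphere_measure) = (\<integral>x. f x \<partial>sphere_measure)"
proof -
  let ?M = "sphere_measure :: (real ^ 'n) measure"
  have T_borel: "T \<in> borel_measurable borel"
    using T by (intro borel_measurable_continuous_onI linear_continuous_on linear_conv_bounded_linear[THEN iffD1])
      (rule orthogonal_transformation_linear)
  have "T \<in> restrict_space borel (sphere 0 1) \<rightarrow>\<^sub>M restrict_space borel (sphere 0 1)"
    using T_borel
    by (auto intro!: measurable_restrict_space3 simp: orthogonal_transformation_norm[OF T])
  then have meas: "T \<in> ?M \<rightarrow>\<^sub>M ?M"
    by (simp add: measurable_cong_sets[OF sets_sphere_measure sets_sphere_measure])
  have T0: "T v = 0 \<longleftrightarrow> v = 0" for v
    by (metis norm_eq_zero orthogonal_transformation_norm[OF T])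
  have "distr ?M ?M T = ?M"
  proof (rule measure_eqI)
    fix A assume "A \<in> sets (distr ?M ?M T)"
    then have A: "A \<in> sets borel" "A \<subseteq> sphere 0 1" and A': "A \<in> sets ?M"
      by (auto simp: sets_sphere_measure sets_restrict_space_sphere)
    have TA: "T -` A \<subseteq> sphere 0 1"
      using A(2) by (auto simp: orthogonal_transformation_norm[OF T] dest!: subsetD)
    have TA': "T -` A \<in> sets borel"
      using measurable_sets[OF T_borel A(1)] by simp
    have "sgn -` T -` A \<inter> (cball 0 1 - {0}) = T -` (sgn -` A \<inter> (cball 0 1 - {0}))"
      by (auto simp: sgn_orthogonal_transformation[OF T] orthogonal_transformation_norm[OF T] T0)
    moreover have "sgn -` A \<inter> (cball 0 1 - {0}) \<in> sets borel"
      using measurable_sets[OF borel_measurable_sgn_vector A(1)] by auto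
    ultimately have "emeasure ?M (T -` A) = emeasure ?M A"
      using A TA TA' by (simp add: emeasure_sphere_measure emeasure_lborel_orthogonal_vimage[OF T] del: vimage_Int)
    moreover have "T -` A \<inter> space ?M = T -` A"
      using TA by auto
    ultimately show "emeasure (distr ?M ?M T) A = emeasure ?M A"
      using meas A' by (simp add: emeasure_distr)
  qed simp
  moreover have "(\<integral>x. f x \<partial>distr ?M ?M T) = (\<integral>x. f (T x) \<partial>?M)"
    by (rule integral_distr[OF meas]) (rule borel_measurable_on_sphere[OF sets_sphere_measure f])
  ultimately show ?thesis
    by simp
qed

text \<open>Definiteness of the \<open>L^2\<close> form on continuous functions: the set where
  \<open>f\<close> is nonzero is relatively open, so the cone over it contains a nonempty open set,
  which has positive volume.\<close>

lemma integral_sphere_measure_square_eq_0: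
  fixes f :: "real ^ 'n \<Rightarrow> real"
  assumes f: "continuous_on (sphere 0 1) f" and 0: "(\<integral>x. (f x)\<^sup>2 \<partial>sphere_measure) = 0"
    and x: "x \<in> sphere 0 1"
  shows "f x = 0"
proof (rule ccontr)
  assume nz: "f x \<noteq> 0"
  let ?M = "sphere_measure :: (real ^ 'n) measure"
  define A where "A = {y \<in> sphere 0 1. f y \<noteq> 0}"
  have "A = f -` (- {0}) \<inter> sphere 0 1"
    by (auto simp: A_def)
  then obtain U where U: "open U" "A = U \<inter> sphere 0 1"
    using f continuous_on_open_invariant[of "sphere 0 1" f] by (metis open_Compl closed_singleton)
  have A: "A \<in> sets borel" "A \<subseteq> sphere 0 1"
    using U by auto
  have "AE y in ?M. (f y)\<^sup>2 = 0"
    using 0 by (subst integral_nonneg_eq_0_iff_AE[symmetric])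
      (auto intro!: integrable_sphere_measure continuous_intros f)
  then have "AE y in ?M. y \<notin> A"
    by eventually_elim (auto simp: A_def)
  then have "emeasure ?M A = 0"
    using A by (subst (asm) AE_iff_measurable[where N = A])
      (auto simp: sets_sphere_measure sets_restrict_space_sphere A_def)
  then have null: "emeasure lborel (sgn -` A \<inter> (cball 0 1 - {0})) = 0"
    using A emeasure_lborel_ball_finite[of "0::real^'n" 1]
    by (auto simp: emeasure_sphere_measure ennreal_divide_eq_0_iff)
  define W where "W = (sgn -` U \<inter> - {0}) \<inter> ball (0::real^'n) 1"
  have "continuous_on (- {0::real^'n}) sgn"
    by (intro continuous_on_sgn continuous_on_id) auto
  then have "open (sgn -` U \<inter> - {0::real^'n})"
    using U(1) by (subst (asm) continuous_on_open_vimage) (auto simp: open_Compl)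
  then have "open W"
    by (auto simp: W_def)
  \<comment> \<open>The point \<open>x\<close> itself lies on the boundary of the ball; its half
    lies inside and has the same direction.\<close>
  moreover have "x /\<^sub>R 2 \<in> W"
  proof -
    have "x \<in> A" using x nz by (simp add: A_def)
    then have "x \<in> U" using U by auto
    moreover have "sgn (x /\<^sub>R 2) = x" using x by (simp add: sgn_scaleR sgn_div_norm[of x])
    moreover have "x \<noteq> 0" using x by auto
    ultimately show ?thesis using x by (simp add: W_def)
  qed
  ultimately have "emeasure lborel W > 0"
    by (intro emeasure_lborel_open_pos) auto
  moreover have "W \<subseteq> sgn -` A \<inter> (cball 0 1 - {0})"
    by (auto simp: W_def U norm_sgn)
  then have "emeasure lborel W \<le> emeasure lborel (sgn -` A \<inter> (cball 0 1 - {0}))"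
    using measurable_sets[OF borel_measurable_sgn_vector A(1)] by (intro emeasure_mono) auto
  ultimately show False
    using null by simp
qed

section \<open>Zonal integrals\<close>

text \<open>A rotation takes the axis \<open>i\<close> to \<open>u\<close>. All zonal integrals thus
  become integrals of a function of one fixed coordinate.\<close>

lemma integral_sphere_measure_zonal:
  fixes u :: "real ^ 'n" and i :: 'n and g :: "real \<Rightarrow> real"
  assumes u: "norm u = 1" and g: "continuous_on UNIV g"
  shows "(\<integral>y. g (u \<bullet> y) \<partial>sphere_measure) = (\<integral>y. g (y $ i) \<partial>sphere_measure)"
proof -
  obtain T where T: "orthogonal_transformation T" "T (axis i (1::real)) = u"
    by (rule orthogonal_transformation_exists_1[of "axis i (1::real)" u]) (auto simp: u norm_axis_1)
  have "u \<bullet> T y = y $ i" for y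
    using T by (metis orthogonal_transformation_def inner_axis' mult_1 real_inner_1_right inner_real_def)
  moreover have "continuous_on (sphere 0 1) (\<lambda>y. g (u \<bullet> y))"
    by (intro continuous_on_compose2[OF g] continuous_intros) auto
  ultimately show ?thesis
    using integral_sphere_measure_orthogonal[OF T(1), of "\<lambda>y. g (u \<bullet> y)"] by simp
qed

text \<open>The constant coefficient is included to make the induction for the quadratic one
  work.\<close>

lemma coeff_one_plus_square_power:
  "coeff ([:1, 0, 1::real:] ^ k) 0 = 1 \<and> coeff ([:1, 0, 1::real:] ^ k) (Suc (Suc 0)) = of_nat k"
  by (induction k) auto

definition coord_moment :: "'n::finite \<Rightarrow> nat \<Rightarrow> real" where
  "coord_moment i k = (\<integral>y. (y $ i) ^ k \<partial>(sphere_measure :: (real ^ 'n) measure))"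

lemma coord_moment_odd:
  assumes "odd k"
  shows "coord_moment (i::'n::finite) k = 0"
proof -
  have "(\<integral>y. (- axis i 1 \<bullet> y) ^ k \<partial>(sphere_measure :: (real ^ 'n) measure)) = coord_moment i k"
    unfolding coord_moment_def
    by (rule integral_sphere_measure_zonal[of _ "\<lambda>s. s ^ k"]) (auto intro!: continuous_intros)
  then show ?thesis
    using assms by (simp add: coord_moment_def inner_axis' power_minus_odd)
qed

text \<open>Comparing the coefficients of \<open>s\<^sup>2\<close> in
  \<open>\<integral> (y\<^sub>i + s y\<^sub>j)\<^sup>2\<^sup>k = (1 + s\<^sup>2)\<^sup>k \<integral> y\<^sub>i\<^sup>2\<^sup>k\<close>, which is rotation invariance.\<close>

lemma coord_moment_mixed:
  fixes i j :: "'n::finite"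
  assumes "i \<noteq> j" "k \<ge> 1"
  shows "(2 * real k - 1) * (\<integral>y. (y $ j)\<^sup>2 * (y $ i) ^ (2 * k - 2) \<partial>(sphere_measure :: (real ^ 'n) measure))
    = coord_moment i (2 * k)"
proof -
  let ?M = "sphere_measure :: (real ^ 'n) measure"
  define J where "J l = (\<integral>y. (y $ j) ^ l * (y $ i) ^ (2 * k - l) \<partial>?M)" for l
  define p where "p = (\<Sum>l\<le>2 * k. monom (of_nat (2 * k choose l) * J l) l)"
  define q where "q = smult (coord_moment i (2 * k)) ([:1, 0, 1:] ^ k)"
  have "poly p s = poly q s" for s
  proof -
    \<comment> \<open>The norm of \<open>w\<close> is \<open>sqrt (1 + s^2)\<close> and
      \<open>sgn w\<close> is a unit vector, so invariance evaluates the integral of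
      \<open>(w . y)^(2k)\<close> for every \<open>s\<close>: an identity of polynomials in
      \<open>s\<close>.\<close>
    define w where "w = axis i 1 + s *\<^sub>R axis j (1::real)"
    have wy: "w \<bullet> y = y $ i + s * y $ j" for y
      by (simp add: w_def inner_add_left inner_axis')
    have ww: "w \<bullet> w = 1 + s\<^sup>2"
      using assms by (subst wy) (auto simp: w_def axis_def power2_eq_square)
    have pos: "1 + s\<^sup>2 > 0"
      by (simp add: add_pos_nonneg)
    have nw: "norm w = sqrt (1 + s\<^sup>2)"
      by (simp add: norm_eq_sqrt_inner ww)
    have "(\<integral>y. (w \<bullet> y) ^ (2 * k) \<partial>?M) = (\<integral>y. (1 + s\<^sup>2) ^ k * ((sgn w) \<bullet> y) ^ (2 * k) \<partial>?M)"
      using pos by (simp add: sgn_div_norm nw power_mult_distrib power_mult power_divide divide_simps)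
    also have "\<dots> = (1 + s\<^sup>2) ^ k * coord_moment i (2 * k)"
      using pos nw integral_sphere_measure_zonal[of "sgn w" "\<lambda>s. s ^ (2 * k)" i]
      by (cases "w = 0") (auto simp: coord_moment_def norm_sgn continuous_intros)
    finally have 1: "(\<integral>y. (w \<bullet> y) ^ (2 * k) \<partial>?M) = poly q s"
      by (simp add: q_def power2_eq_square)
    have "(\<integral>y. (w \<bullet> y) ^ (2 * k) \<partial>?M)
        = (\<integral>y. (\<Sum>l\<le>2 * k. of_nat (2 * k choose l) * s ^ l * ((y $ j) ^ l * (y $ i) ^ (2 * k - l))) \<partial>?M)"
      by (simp add: wy add.commute[of "_ $ i"] binomial_ring power_mult_distrib mult_ac)
    also have "\<dots> = (\<Sum>l\<le>2 * k. of_nat (2 * k choose l) * s ^ l * J l)"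
      unfolding J_def
      by (subst Bochner_Integration.integral_sum)
        (auto intro!: integrable_sphere_measure continuous_intros)
    also have "\<dots> = poly p s"
      by (simp add: p_def poly_sum poly_monom mult_ac)
    finally show ?thesis using 1 by simp
  qed
  then have "p = q"
    by (simp add: poly_eq_poly_eq_iff[symmetric] fun_eq_iff)
  then have "coeff p 2 = coeff q 2" by simp
  moreover have "coeff p 2 = of_nat (2 * k choose 2) * J 2"
    using assms by (simp add: p_def coeff_sum)
  moreover have "coeff q 2 = coord_moment i (2 * k) * k"
    using coeff_one_plus_square_power[of k] by (simp add: q_def numeral_2_eq_2)
  \<comment> \<open>The common factor \<open>k\<close> of both coefficients cancels, which leaves
    \<open>2k - 1\<close>.\<close>
  moreover have "real (2 * k choose 2) = k * (2 * real k - 1)"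
    using assms by (simp add: choose_two of_nat_diff)
  ultimately show ?thesis
    using assms by (simp add: J_def mult_ac)
qed

text \<open>This is the integration by parts rule for \<open>p = x^k\<close>. For odd
  \<open>k\<close> the mixed moments are summed over the \<open>d\<close> indices \<open>j\<close>
  other than \<open>i\<close>, where the squares \<open>(y $ j)^2\<close> add up to
  \<open>1 - (y $ i)^2\<close>; for even \<open>k\<close> parity makes both sides zero.\<close>

lemma coord_moment_recurrence:
  fixes i :: "'n::finite"
  assumes dim: "CARD('n) = d + 1"
  shows "real k * (coord_moment i (k - 1) - coord_moment i (Suc k)) = real d * coord_moment i (Suc k)"
proof (cases "even k")
  case True
  \<comment> \<open>At \<open>k = 0\<close> the truncated index \<open>k - 1\<close> refers to the
    nonzero moment \<open>coord_moment i 0\<close>, but its factor \<open>k\<close> is zero.\<close>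
  then have "coord_moment i (Suc k) = 0" "k = 0 \<or> coord_moment i (k - 1) = 0"
    by (auto intro!: coord_moment_odd)
  then show ?thesis by auto
next
  case False
  then obtain l where "k = 2 * l + 1" by (auto elim: oddE)
  then obtain m where k: "k = 2 * m - 1" "m \<ge> 1" by (intro that[of "Suc l"]) auto
  let ?M = "sphere_measure :: (real ^ 'n) measure"
  have "real d * coord_moment i (2 * m) = (\<Sum>j\<in>UNIV - {i}. coord_moment i (2 * m))"
    using dim by simp
  also have "\<dots> = (\<Sum>j\<in>UNIV - {i}. (2 * real m - 1) * (\<integral>y. (y $ j)\<^sup>2 * (y $ i) ^ (2 * m - 2) \<partial>?M))"
    using k by (intro sum.cong) (auto simp: coord_moment_mixed)
  also have "\<dots> = (2 * real m - 1) * (\<integral>y. (\<Sum>j\<in>UNIV - {i}. (y $ j)\<^sup>2 * (y $ i) ^ (2 * m - 2)) \<partial>?M)"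
    unfolding sum_distrib_left[symmetric]
    by (subst Bochner_Integration.integral_sum) (auto intro!: integrable_sphere_measure continuous_intros)
  also have "(\<integral>y. (\<Sum>j\<in>UNIV - {i}. (y $ j)\<^sup>2 * (y $ i) ^ (2 * m - 2)) \<partial>?M)
      = (\<integral>y. (y $ i) ^ (2 * m - 2) - (y $ i) ^ (2 * m) \<partial>?M)"
  proof (rule Bochner_Integration.integral_cong)
    fix y :: "real ^ 'n" assume "y \<in> space ?M"
    then have "(\<Sum>j\<in>UNIV. (y $ j)\<^sup>2) = 1"
      by (simp add: norm_vec_def L2_set_def)
    then have "(\<Sum>j\<in>UNIV - {i}. (y $ j)\<^sup>2) = 1 - (y $ i)\<^sup>2"
      by (subst (asm) sum.remove[of _ i]) auto
    moreover have "2 * m = 2 + (2 * m - 2)" using k by simp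
    then have "(y $ i) ^ (2 * m) = (y $ i)\<^sup>2 * (y $ i) ^ (2 * m - 2)"
      by (metis power_add)
    ultimately show "(\<Sum>j\<in>UNIV - {i}. (y $ j)\<^sup>2 * (y $ i) ^ (2 * m - 2)) = (y $ i) ^ (2 * m - 2) - (y $ i) ^ (2 * m)"
      by (simp add: sum_distrib_right[symmetric] left_diff_distrib)
  qed simp
  also have "\<dots> = coord_moment i (2 * m - 2) - coord_moment i (2 * m)"
    unfolding coord_moment_def
    by (rule Bochner_Integration.integral_diff) (auto intro!: integrable_sphere_measure continuous_intros)
  finally show ?thesis
    using k by (simp add: of_nat_diff numeral_2_eq_2)
qed

definition zonal_integral :: "'n::finite \<Rightarrow> real poly \<Rightarrow> real" where
  "zonal_integral i p = (\<integral>y. poly p (y $ i) \<partial>(sphere_measure :: (real ^ 'n) measure))"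

lemma zonal_integral_add:
  "zonal_integral (i::'n::finite) (p + q) = zonal_integral i p + zonal_integral i q"
  unfolding zonal_integral_def poly_add
  by (rule Bochner_Integration.integral_add) (auto intro!: integrable_sphere_measure continuous_intros)

lemma zonal_integral_smult: "zonal_integral (i::'n::finite) (smult c p) = c * zonal_integral i p"
  by (simp add: zonal_integral_def)

lemma zonal_integral_monom: "zonal_integral (i::'n::finite) (monom c k) = c * coord_moment i k"
  by (simp add: zonal_integral_def poly_monom coord_moment_def)

lemma zonal_integral_reflect:
  assumes "\<And>x. poly q x = poly p (- x)"
  shows "zonal_integral (i::'n::finite) q = zonal_integral i p"
proof -
  have "(\<integral>y. poly p (- axis i 1 \<bullet> y) \<partial>(sphere_measure :: (real ^ 'n) measure)) = zonal_integral i p"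
    unfolding zonal_integral_def
    by (rule integral_sphere_measure_zonal) (auto intro!: continuous_intros)
  then show ?thesis
    by (simp add: zonal_integral_def inner_axis' assms)
qed

text \<open>Classically this is integration by parts against the density \<open>w\<close>, a
  multiple of \<open>(1 - x^2)^(d/2 - 1)\<close>, for which \<open>((1 - x^2) w)' = - d x w\<close>.
  Here it follows by linearity from the moment recurrence.\<close>

lemma zonal_integral_pearson:
  fixes i :: "'n::finite"
  assumes dim: "CARD('n) = d + 1"
  shows "zonal_integral i ([:1, 0, -1:] * pderiv p) = real d * zonal_integral i ([:0, 1:] * p)"
proof -
  have monom: "zonal_integral i ([:1, 0, -1:] * pderiv (monom c k)) = real d * zonal_integral i ([:0, 1:] * monom c k)"
    for c k
  proof -
    have "[:1, 0, -1:] * pderiv (monom c k) = monom (of_nat k * c) (k - 1) + monom (- of_nat k * c) (Suc k)"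
    proof (cases k)
      case 0
      then show ?thesis by (simp add: pderiv_monom)
    next
      case (Suc l)
      then have "pderiv (monom c k) = monom (of_nat k * c) l"
        by (simp add: pderiv_monom)
      then show ?thesis using Suc by (simp add: monom_Suc minus_monom algebra_simps)
    qed
    moreover have "[:0, 1:] * monom c k = monom c (Suc k)"
      by (simp add: monom_Suc)
    ultimately show ?thesis
      using coord_moment_recurrence[OF dim, of k i]
      by (simp add: zonal_integral_add zonal_integral_monom algebra_simps del: of_nat_Suc)
  qed
  have "zonal_integral i ([:1, 0, -1:] * pderiv (\<Sum>k\<le>N. monom (coeff p k) k))
      = real d * zonal_integral i ([:0, 1:] * (\<Sum>k\<le>N. monom (coeff p k) k))" for N
  proof (induction N)
    case 0
    show ?case using monom[of _ 0] by simp
  next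
    case (Suc N)
    then show ?case
      by (simp only: sum.atMost_Suc monom pderiv_add distrib_left zonal_integral_add)
  qed
  from this[of "degree p"] show ?thesis
    by (simp only: poly_as_sum_of_monoms)
qed

section \<open>Gegenbauer polynomials\<close>

text \<open>Power series coefficients of the solution of
  \<open>(1 - x^2) P'' - d x P' + n (n + d - 1) P = 0\<close> with the parity of \<open>n\<close>,
  normalized by lowest coefficient 1. The numerator vanishes at \<open>j = n\<close>, so the series
  stops there.\<close>

fun gegenbauer_coeff :: "nat \<Rightarrow> nat \<Rightarrow> nat \<Rightarrow> real" where
  "gegenbauer_coeff d n 0 = (if even n then 1 else 0)"
| "gegenbauer_coeff d n (Suc 0) = (if odd n then 1 else 0)"
| "gegenbauer_coeff d n (Suc (Suc j)) =
    (real j * (real j + real d - 1) - real n * (real n + real d - 1)) / (real (Suc (Suc j)) * real (Suc j))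
      * gegenbauer_coeff d n j"

lemma gegenbauer_coeff_parity: "odd (n + j) \<Longrightarrow> gegenbauer_coeff d n j = 0"
  by (induction d n j rule: gegenbauer_coeff.induct) auto

lemma gegenbauer_coeff_eq_0: "j > n \<Longrightarrow> gegenbauer_coeff d n j = 0"
proof (induction d n j rule: gegenbauer_coeff.induct)
  case (3 d n j)
  then consider "j > n" | "j = n" | "n = Suc j" by linarith
  then show ?case
    using 3 by cases (auto simp: gegenbauer_coeff_parity)
qed auto

text \<open>The numerator factors as \<open>(j - n) (j + n + d - 1)\<close>, which is nonzero before
  the series stops. This makes the degree exactly \<open>n\<close>, and later \<open>P''\<close>
  nonzero.\<close>

lemma gegenbauer_coeff_neq_0:
  "even (n + j) \<Longrightarrow> j \<le> n \<Longrightarrow> d \<ge> 1 \<Longrightarrow> gegenbauer_coeff d n j \<noteq> 0"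
proof (induction d n j rule: gegenbauer_coeff.induct)
  case (3 d n j)
  have "real j * (real j + real d - 1) - real n * (real n + real d - 1) = (real j - real n) * (real j + real n + real d - 1)"
    by (simp add: algebra_simps)
  moreover have "real j - real n \<noteq> 0" "real j + real n + real d - 1 > 0"
    using 3 by auto
  ultimately have "real j * (real j + real d - 1) - real n * (real n + real d - 1) \<noteq> 0"
    by simp
  then show ?case using 3 by simp
qed auto

definition gegenbauer :: "nat \<Rightarrow> nat \<Rightarrow> real poly" where
  "gegenbauer d n = (\<Sum>j\<le>n. monom (gegenbauer_coeff d n j) j)"

lemma coeff_gegenbauer: "coeff (gegenbauer d n) j = gegenbauer_coeff d n j"
  by (simp add: gegenbauer_def coeff_sum gegenbauer_coeff_eq_0)

lemma degree_gegenbauer: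
  assumes "d \<ge> 1"
  shows "degree (gegenbauer d n) = n"
proof (rule antisym)
  show "degree (gegenbauer d n) \<le> n"
    by (rule degree_le) (simp add: coeff_gegenbauer gegenbauer_coeff_eq_0)
  show "n \<le> degree (gegenbauer d n)"
    using assms by (intro le_degree) (simp add: coeff_gegenbauer gegenbauer_coeff_neq_0)
qed

lemma poly_gegenbauer_minus: "poly (gegenbauer d n) (- x) = (-1) ^ n * poly (gegenbauer d n) x"
  unfolding gegenbauer_def poly_sum sum_distrib_left poly_monom
proof (rule sum.cong[OF refl])
  fix j
  show "gegenbauer_coeff d n j * (- x) ^ j = (- 1) ^ n * (gegenbauer_coeff d n j * x ^ j)"
  proof (cases "even (n + j)")
    case True
    then show ?thesis by (cases "even n") auto
  qed (simp add: gegenbauer_coeff_parity)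
qed

lemma poly_pderiv_minus:
  fixes p :: "real poly"
  assumes "\<And>x. poly p (- x) = s * poly p x"
  shows "poly (pderiv p) (- x) = - s * poly (pderiv p) x"
proof -
  have "p \<circ>\<^sub>p [:0, -1:] = smult s p"
    unfolding poly_eq_poly_eq_iff[symmetric] fun_eq_iff by (simp add: poly_pcompose assms)
  from arg_cong[OF this, of "\<lambda>p. poly (pderiv p) x"] show ?thesis
    by (simp add: pderiv_pcompose poly_pcompose pderiv_smult pderiv_pCons)
qed

lemma gegenbauer_ode:
  "[:1, 0, -1:] * pderiv (pderiv (gegenbauer d n)) =
    smult (real d) ([:0, 1:] * pderiv (gegenbauer d n)) - smult (real n * (real n + real d - 1)) (gegenbauer d n)"
proof (rule poly_eqI)
  fix j
  let ?c = "gegenbauer_coeff d n" and ?lam = "real n * (real n + real d - 1)"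
  have rec: "real (Suc (Suc j)) * real (Suc j) * ?c (Suc (Suc j)) = (real j * (real j + real d - 1) - ?lam) * ?c j"
    by (simp add: field_simps del: of_nat_Suc)
  consider "j = 0" | "j = Suc 0" | i where "j = Suc (Suc i)"
    by (metis not0_implies_Suc)
  then show "coeff ([:1, 0, -1:] * pderiv (pderiv (gegenbauer d n))) j =
    coeff (smult (real d) ([:0, 1:] * pderiv (gegenbauer d n)) - smult ?lam (gegenbauer d n)) j"
    using rec
    by cases (simp_all add: coeff_pderiv coeff_gegenbauer algebra_simps del: gegenbauer_coeff.simps)
qed

text \<open>The Gegenbauer computations are pure algebra from these rules; the instance is
  \<open>zonal_integral\<close>.\<close>

locale pearson_functional =
  fixes L :: "real poly \<Rightarrow> real" and d :: nat
  assumes add: "L (p + q) = L p + L q"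
    and smult: "L (smult c p) = c * L p"
    and pearson: "L ([:1, 0, -1:] * pderiv p) = real d * L ([:0, 1:] * p)"
    and reflect: "(\<And>x. poly q x = poly p (- x)) \<Longrightarrow> L q = L p"
    and d_pos: "d \<ge> 1"
begin

lemma zero: "L 0 = 0"
  using smult[of 0 0] by simp

lemma minus: "L (- p) = - L p"
  using add[of p "- p"] zero by simp

lemma diff: "L (p - q) = L p - L q"
  using add[of "p - q" q] by simp

lemma sum: "L (\<Sum>i\<in>I. f i) = (\<Sum>i\<in>I. L (f i))"
  by (induction I rule: infinite_finite_induct) (auto simp: add zero)

text \<open>The rule \<open>pearson\<close> applied to \<open>q * pderiv p\<close>. As the left side
  is symmetric in \<open>p\<close> and \<open>q\<close>, the operator
  \<open>D p = (1 - x^2) p'' - d x p'\<close> is self-adjoint for \<open>L\<close>.\<close>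

lemma symmetric_form:
  "L ([:1, 0, -1:] * pderiv p * pderiv q) = - L (q * ([:1, 0, -1:] * pderiv (pderiv p) - smult (real d) ([:0, 1:] * pderiv p)))"
proof -
  have "[:1, 0, -1:] * pderiv (q * pderiv p) =
      [:1, 0, -1:] * pderiv p * pderiv q + (q * ([:1, 0, -1:] * pderiv (pderiv p) - smult (real d) ([:0, 1:] * pderiv p)))
        + smult (real d) ([:0, 1:] * (q * pderiv p))"
    unfolding poly_eq_poly_eq_iff[symmetric] fun_eq_iff
    by (auto simp: pderiv_mult algebra_simps)
  with pearson[of "q * pderiv p"] show ?thesis
    by (simp add: add smult del: mult_pCons_left)
qed

text \<open>\<open>P\<close> is an eigenvector of \<open>D\<close> for \<open>- lam n\<close>, and
  \<open>D x^k = k (k - 1) x^(k-2) - lam k x^k\<close>. Self-adjointness and induction leave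
  \<open>(lam n - lam k) L (P x^k) = 0\<close>, with distinct eigenvalues.\<close>

lemma gegenbauer_orthogonal_monom:
  assumes "k < n"
  shows "L (gegenbauer d n * monom 1 k) = 0"
  using assms
proof (induction k rule: less_induct)
  case (less k)
  define P where "P = gegenbauer d n"
  define lam where "lam m = real m * (real m + real d - 1)" for m
  let ?D = "\<lambda>p. [:1, 0, -1:] * pderiv (pderiv p) - smult (real d) ([:0, 1:] * pderiv p)"
  have DP: "?D P = smult (- lam n) P"
    by (simp add: P_def lam_def gegenbauer_ode del: mult_pCons_left)
  have Dm: "?D (monom 1 k) = smult (real k * (real k - 1)) (monom 1 (k - 2)) - smult (lam k) (monom 1 k)"
  proof -
    consider "k = 0" | "k = Suc 0" | l where "k = Suc (Suc l)"
      by (metis not0_implies_Suc)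
    then show ?thesis
      unfolding poly_eq_poly_eq_iff[symmetric] fun_eq_iff
      by cases (auto simp: pderiv_monom poly_monom lam_def pderiv_pCons algebra_simps)
  qed
  have "L (monom 1 k * ?D P) = L (P * ?D (monom 1 k))"
    using symmetric_form[of P "monom 1 k"] symmetric_form[of "monom 1 k" P] by (simp only: mult_ac neg_equal_iff_equal)
  then have "- lam n * L (P * monom 1 k) = real k * (real k - 1) * L (P * monom 1 (k - 2)) - lam k * L (P * monom 1 k)"
    unfolding DP Dm by (simp add: right_diff_distrib diff smult minus mult.commute[of P])
  \<comment> \<open>For \<open>k < 2\<close> the index \<open>k - 2\<close> is truncated, but then
    \<open>k (k - 1) = 0\<close>.\<close>
  moreover have "real k * (real k - 1) * L (P * monom 1 (k - 2)) = 0"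
  proof (cases "k \<ge> 2")
    case True
    then show ?thesis using less by (simp add: P_def)
  next
    case False
    then have "k = 0 \<or> k = 1" by auto
    then show ?thesis by auto
  qed
  ultimately have "(lam n - lam k) * L (P * monom 1 k) = 0"
    unfolding left_diff_distrib by linarith
  moreover have "lam n - lam k = (real n - real k) * (real n + real k + real d - 1)"
    by (simp add: lam_def algebra_simps)
  moreover have "real n - real k > 0" "real n + real k + real d - 1 > 0"
    using less.prems d_pos by auto
  ultimately show ?case
    by (simp add: P_def)
qed

lemma gegenbauer_orthogonal:
  assumes "degree q < n"
  shows "L (gegenbauer d n * q) = 0"
proof -
  have "gegenbauer d n * q = gegenbauer d n * (\<Sum>k\<le>degree q. smult (coeff q k) (monom 1 k))"
    by (simp add: smult_monom poly_as_sum_of_monoms)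
  also have "L \<dots> = 0"
    using assms by (simp add: sum_distrib_left sum smult gegenbauer_orthogonal_monom)
  finally show ?thesis .
qed

lemma odd_eq_0:
  assumes "\<And>x. poly p (- x) = - poly p x"
  shows "L p = 0"
proof -
  have "L (smult (-1) p) = L p"
    by (rule reflect) (simp add: assms)
  then show ?thesis by (simp add: smult del: smult_minus_left)
qed

text \<open>With \<open>P\<close> the Gegenbauer polynomial, \<open>B = L ((1 - x\<^sup>2) P''\<^sup>2)\<close> and \<open>Z = L (x\<^sup>2 P''\<^sup>2)\<close>,
  the differential equation gives \<open>B = d L (x P' P'')\<close>, and its derivative together with the
  integration by parts for \<open>x P''\<^sup>2\<close> gives \<open>d (d + 4) Z = (2 \<lambda> - 3 d) B\<close>.\<close>

lemma localized_polynomial: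
  fixes n :: nat
  defines "q \<equiv> [:1, 1:] * pderiv (pderiv (gegenbauer d n))"
  assumes n: "n \<ge> 2"
  shows "(4 * (real n * (real n + real d - 1)) + (real d)\<^sup>2 - 2 * real d) * L ([:1, -1:] * q\<^sup>2)
    = real d * (real d + 4) * L (q\<^sup>2)"
proof -
  define P where "P = gegenbauer d n"
  define P1 where "P1 = pderiv P"
  define P2 where "P2 = pderiv P1"
  define P3 where "P3 = pderiv P2"
  define lam where "lam = real n * (real n + real d - 1)"
  define B where "B = L ([:1, 0, -1:] * P2\<^sup>2)"
  define Z where "Z = L ([:0, 1:] * ([:0, 1:] * P2\<^sup>2))"
  define Y where "Y = L ([:0, 1:] * P1 * P2)"
  note ode = gegenbauer_ode[of d n, folded P_def, folded P1_def, folded P2_def, folded lam_def]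
  have W: "pderiv ([:1, 0, -1:] * P2) = [:1, 0, -1:] * P3 - smult 2 ([:0, 1:] * P2)"
    unfolding pderiv_mult poly_eq_poly_eq_iff[symmetric] fun_eq_iff
    by (simp add: pderiv_pCons P3_def)
  have "pderiv ([:0, 1:] * P1) = P1 + [:0, 1:] * P2"
    by (simp add: pderiv_pCons P2_def)
  then have "[:1, 0, -1:] * P3 - smult 2 ([:0, 1:] * P2) = smult (real d) (P1 + [:0, 1:] * P2) - smult lam P1"
    using arg_cong[OF ode, of pderiv] unfolding W pderiv_diff pderiv_smult P1_def[symmetric] by simp
  then have "poly ([:1, 0, -1:] * P3 - smult 2 ([:0, 1:] * P2)) x
      = poly (smult (real d) (P1 + [:0, 1:] * P2) - smult lam P1) x" for x
    by (rule arg_cong)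
  \<comment> \<open>The differentiated equation is again of Gegenbauer type, for \<open>P1\<close>
    and with \<open>d + 2\<close> in place of \<open>d\<close>; it will eliminate
    \<open>P3\<close>.\<close>
  then have ode': "[:1, 0, -1:] * P3 = smult (real d + 2) ([:0, 1:] * P2) - smult (lam - real d) P1"
    unfolding poly_eq_poly_eq_iff[symmetric] fun_eq_iff
    by (simp add: algebra_simps)
  have evenP2: "(poly P2 (- x))\<^sup>2 = (poly P2 x)\<^sup>2" for x
  proof -
    have "poly P1 (- x) = - ((-1) ^ n) * poly P1 x" for x
      unfolding P1_def P_def by (rule poly_pderiv_minus) (rule poly_gegenbauer_minus)
    then have "poly P2 (- x) = - (- ((-1) ^ n)) * poly P2 x" for x
      unfolding P2_def by (rule poly_pderiv_minus)
    then show ?thesis by (simp add: power_mult_distrib flip: power_mult)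
  qed
  have deg: "degree P2 < n"
    using n by (simp add: P2_def P1_def P_def degree_pderiv degree_gegenbauer[OF d_pos])
  \<comment> \<open>The differential equation times \<open>P2\<close>; the term
    \<open>L (P * P2)\<close> vanishes by orthogonality, as \<open>P2\<close> has smaller degree
    than \<open>P\<close>.\<close>
  have "[:1, 0, -1:] * P2\<^sup>2 = smult (real d) ([:0, 1:] * P1 * P2) - smult lam (P * P2)"
    unfolding power2_eq_square mult.assoc[symmetric] ode by (simp add: left_diff_distrib)
  then have B: "B = real d * Y"
    using gegenbauer_orthogonal[OF deg] by (simp add: B_def Y_def diff smult P_def del: mult_pCons_left)
  have "[:1, 0, -1:] * pderiv ([:0, 1:] * P2\<^sup>2) = [:1, 0, -1:] * P2\<^sup>2 + smult 2 ([:0, 1:] * P2 * ([:1, 0, -1:] * P3))"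
    unfolding poly_eq_poly_eq_iff[symmetric] fun_eq_iff
    by (auto simp: pderiv_mult power2_eq_square pderiv_pCons algebra_simps P3_def[symmetric])
  also have "\<dots> = [:1, 0, -1:] * P2\<^sup>2 + smult (2 * (real d + 2)) ([:0, 1:] * ([:0, 1:] * P2\<^sup>2))
      - smult (2 * (lam - real d)) ([:0, 1:] * P1 * P2)"
    unfolding ode' poly_eq_poly_eq_iff[symmetric] fun_eq_iff
    by (auto simp: power2_eq_square algebra_simps)
  finally have "real d * Z = B + 2 * (real d + 2) * Z - 2 * (lam - real d) * Y"
    using pearson[of "[:0, 1:] * P2\<^sup>2"] by (simp add: add diff smult B_def Z_def Y_def del: mult_pCons_left)
  then have "(real d + 4) * Z = 2 * (lam - real d) * Y - B"
    by (simp add: algebra_simps)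
  \<comment> \<open>The factor \<open>d\<close> allows \<open>Y\<close> to be replaced through
    \<open>B = d * Y\<close>.\<close>
  then have "real d * ((real d + 4) * Z) = real d * (2 * (lam - real d) * Y - B)"
    by simp
  then have "real d * (real d + 4) * Z = 2 * (lam - real d) * (real d * Y) - real d * B"
    by (simp add: algebra_simps)
  then have Z: "real d * (real d + 4) * Z = (2 * lam - 3 * real d) * B"
    unfolding B[symmetric] by (simp add: algebra_simps)
  \<comment> \<open>\<open>(1 - x) (1 + x)^2 = (1 - x^2) + x (1 - x^2)\<close>, and the second part
    is odd after multiplication by the even \<open>P2^2\<close>.\<close>
  have "[:1, -1:] * q\<^sup>2 = [:1, 0, -1:] * P2\<^sup>2 + [:0, 1:] * ([:1, 0, -1:] * P2\<^sup>2)"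
    unfolding poly_eq_poly_eq_iff[symmetric] fun_eq_iff
    by (auto simp: q_def power2_eq_square algebra_simps P_def[symmetric] P1_def[symmetric] P2_def[symmetric])
  moreover have "L ([:0, 1:] * ([:1, 0, -1:] * P2\<^sup>2)) = 0"
    by (rule odd_eq_0) (simp add: evenP2)
  ultimately have 1: "L ([:1, -1:] * q\<^sup>2) = B"
    by (simp add: add B_def del: mult_pCons_left)
  \<comment> \<open>\<open>(1 + x)^2 = (1 - x^2) + 2 x^2 + 2 x\<close>, again with an odd last
    part.\<close>
  have "q\<^sup>2 = [:1, 0, -1:] * P2\<^sup>2 + smult 2 ([:0, 1:] * ([:0, 1:] * P2\<^sup>2)) + smult 2 ([:0, 1:] * P2\<^sup>2)"
    unfolding poly_eq_poly_eq_iff[symmetric] fun_eq_iff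
    by (auto simp: q_def power2_eq_square algebra_simps P_def[symmetric] P1_def[symmetric] P2_def[symmetric])
  moreover have "L ([:0, 1:] * P2\<^sup>2) = 0"
    by (rule odd_eq_0) (simp add: evenP2)
  ultimately have 2: "L (q\<^sup>2) = B + 2 * Z"
    by (simp add: add smult B_def Z_def del: mult_pCons_left)
  \<comment> \<open>\<open>d (d + 4) (B + 2 Z) = (d (d + 4) + 2 (2 lam - 3 d)) B\<close>, and the
    bracket is \<open>4 lam + d^2 - 2 d\<close>.\<close>
  show ?thesis
    unfolding 1 2 lam_def[symmetric] using Z by (simp add: algebra_simps power2_eq_square)
qed

end

section \<open>Reproducing kernels on the sphere\<close>

definition sphere_ip :: "(real ^ 'n \<Rightarrow> real) \<Rightarrow> (real ^ 'n \<Rightarrow> real) \<Rightarrow> real" where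
  "sphere_ip f g = (\<integral>x. f x * g x \<partial>sphere_measure)"

lemma sphere_ip_commute: "sphere_ip f g = sphere_ip g f"
  by (simp add: sphere_ip_def mult.commute)

lemma sphere_ip_lincomb:
  fixes f :: "'i \<Rightarrow> real ^ 'n \<Rightarrow> real"
  assumes "\<And>j. j \<in> J \<Longrightarrow> continuous_on (sphere 0 1) (f j)" "continuous_on (sphere 0 1) g"
  shows "sphere_ip (\<lambda>x. \<Sum>j\<in>J. c j * f j x) g = (\<Sum>j\<in>J. c j * sphere_ip (f j) g)"
proof -
  have "sphere_ip (\<lambda>x. \<Sum>j\<in>J. c j * f j x) g = (\<integral>x. (\<Sum>j\<in>J. c j * (f j x * g x)) \<partial>sphere_measure)"
    by (simp add: sphere_ip_def sum_distrib_right mult.assoc)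
  also have "\<dots> = (\<Sum>j\<in>J. (\<integral>x. c j * (f j x * g x) \<partial>sphere_measure))"
    by (intro Bochner_Integration.integral_sum integrable_sphere_measure continuous_intros assms)
  finally show ?thesis by (simp add: sphere_ip_def)
qed

lemma sphere_ip_diff:
  assumes "continuous_on (sphere 0 1) f" "continuous_on (sphere 0 1) f'" "continuous_on (sphere 0 1) g"
  shows "sphere_ip (\<lambda>x. f x - f' x) g = sphere_ip f g - sphere_ip f' g"
  unfolding sphere_ip_def left_diff_distrib
  by (intro Bochner_Integration.integral_diff integrable_sphere_measure continuous_intros assms)

text \<open>Equality is required on the sphere only, because the reduction to two degrees of
  homogeneity uses \<open>x . x = 1\<close>.\<close>

definition sphere_span :: "('i \<Rightarrow> real ^ 'n \<Rightarrow> real) \<Rightarrow> 'i set \<Rightarrow> (real ^ 'n \<Rightarrow> real) set" where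
  "sphere_span \<phi> I = {f. \<exists>c. \<forall>x\<in>sphere 0 1. f x = (\<Sum>i\<in>I. c i * \<phi> i x)}"

lemma sphere_span_lincomb:
  assumes "\<And>j. j \<in> J \<Longrightarrow> f j \<in> sphere_span \<phi> I"
  shows "(\<lambda>x. \<Sum>j\<in>J. c j * f j x) \<in> sphere_span \<phi> I"
proof -
  have "\<forall>j\<in>J. \<exists>a. \<forall>x\<in>sphere 0 1. f j x = (\<Sum>i\<in>I. a i * \<phi> i x)"
    using assms by (auto simp: sphere_span_def)
  then obtain a where a: "\<And>j x. j \<in> J \<Longrightarrow> x \<in> sphere 0 1 \<Longrightarrow> f j x = (\<Sum>i\<in>I. a j i * \<phi> i x)"
    by metis
  have "(\<Sum>j\<in>J. c j * f j x) = (\<Sum>i\<in>I. (\<Sum>j\<in>J. c j * a j i) * \<phi> i x)" if "x \<in> sphere 0 1" for x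
  proof -
    have "(\<Sum>j\<in>J. c j * f j x) = (\<Sum>j\<in>J. \<Sum>i\<in>I. c j * a j i * \<phi> i x)"
      using that by (intro sum.cong) (simp_all add: a sum_distrib_left mult.assoc)
    also have "\<dots> = (\<Sum>i\<in>I. \<Sum>j\<in>J. c j * a j i * \<phi> i x)"
      by (rule sum.swap)
    finally show ?thesis by (simp add: sum_distrib_right)
  qed
  then show ?thesis
    unfolding sphere_span_def by (intro CollectI exI[of _ "\<lambda>i. \<Sum>j\<in>J. c j * a j i"]) auto
qed

lemma sphere_span_cong:
  assumes "f \<in> sphere_span \<phi> I" "\<And>x. x \<in> sphere 0 1 \<Longrightarrow> g x = f x"
  shows "g \<in> sphere_span \<phi> I"
  using assms by (auto simp: sphere_span_def)

lemma sphere_span_base: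
  assumes "finite I" "i \<in> I"
  shows "\<phi> i \<in> sphere_span \<phi> I"
  unfolding sphere_span_def using assms
  by (intro CollectI exI[of _ "\<lambda>j. if j = i then 1 else 0"]) (simp add: if_distrib[of "\<lambda>c. c * _"] cong: if_cong)

lemma sphere_span_scale:
  assumes "f \<in> sphere_span \<phi> I"
  shows "(\<lambda>x. c * f x) \<in> sphere_span \<phi> I"
  using sphere_span_lincomb[of "{()}" "\<lambda>_. f" \<phi> I "\<lambda>_. c"] assms by simp

lemma sphere_span_add:
  assumes "f \<in> sphere_span \<phi> I" "g \<in> sphere_span \<phi> I"
  shows "(\<lambda>x. f x + g x) \<in> sphere_span \<phi> I"
  using sphere_span_lincomb[of "{True, False}" "\<lambda>b. if b then f else g" \<phi> I "\<lambda>_. 1"] assms by simp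

lemma sphere_span_mono:
  assumes "finite I'" "I \<subseteq> I'" "f \<in> sphere_span \<phi> I"
  shows "f \<in> sphere_span \<phi> I'"
proof -
  obtain c where c: "\<And>x. x \<in> sphere 0 1 \<Longrightarrow> f x = (\<Sum>i\<in>I. c i * \<phi> i x)"
    using assms(3) by (auto simp: sphere_span_def)
  have "(\<lambda>x. \<Sum>i\<in>I. c i * \<phi> i x) \<in> sphere_span \<phi> I'"
    using assms by (intro sphere_span_lincomb sphere_span_base) auto
  then show ?thesis using c by (rule sphere_span_cong)
qed

lemma continuous_on_sphere_span:
  fixes \<phi> :: "'i \<Rightarrow> real ^ 'n \<Rightarrow> real"
  assumes "\<And>i. i \<in> I \<Longrightarrow> continuous_on (sphere 0 1) (\<phi> i)" "f \<in> sphere_span \<phi> I"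
  shows "continuous_on (sphere 0 1) f"
proof -
  obtain c where c: "\<And>x. x \<in> sphere 0 1 \<Longrightarrow> f x = (\<Sum>i\<in>I. c i * \<phi> i x)"
    using assms(2) by (auto simp: sphere_span_def)
  have "continuous_on (sphere 0 1) (\<lambda>x. \<Sum>i\<in>I. c i * \<phi> i x)"
    by (intro continuous_intros assms)
  then show ?thesis
    using c by (metis (no_types, lifting) continuous_on_cong)
qed

text \<open>The family may be linearly dependent on the sphere; indexing the basis by a subset
  \<open>J\<close> of \<open>I\<close> yields \<open>card J <= card I\<close> at once.\<close>

definition sphere_orthonormal_basis ::
    "('i \<Rightarrow> real ^ 'n \<Rightarrow> real) \<Rightarrow> 'i set \<Rightarrow> ('i \<Rightarrow> real ^ 'n \<Rightarrow> real) \<Rightarrow> 'i set \<Rightarrow> bool" where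
  "sphere_orthonormal_basis \<phi> I \<psi> J \<longleftrightarrow> J \<subseteq> I \<and> (\<forall>j\<in>J. \<psi> j \<in> sphere_span \<phi> I)
    \<and> (\<forall>j\<in>J. \<forall>k\<in>J. sphere_ip (\<psi> j) (\<psi> k) = (if j = k then 1 else 0))
    \<and> (\<forall>i\<in>I. \<phi> i \<in> sphere_span \<psi> J)"

text \<open>The residual \<open>r\<close> of the new function after projection is either normalized
  and added, or has norm zero; then it vanishes on the whole sphere by definiteness, and the index
  is dropped.\<close>

lemma sphere_gram_schmidt:
  fixes \<phi> :: "'i \<Rightarrow> real ^ 'n \<Rightarrow> real"
  assumes "finite I" "\<And>i. i \<in> I \<Longrightarrow> continuous_on (sphere 0 1) (\<phi> i)"
  shows "\<exists>J \<psi>. sphere_orthonormal_basis \<phi> I \<psi> J"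
  using assms
proof (induction I rule: finite_induct)
  case empty
  then show ?case by (auto simp: sphere_orthonormal_basis_def)
next
  case (insert i I)
  from insert.IH insert.prems obtain J \<psi> where basis: "sphere_orthonormal_basis \<phi> I \<psi> J"
    by blast
  have J: "J \<subseteq> I" and span: "\<And>j. j \<in> J \<Longrightarrow> \<psi> j \<in> sphere_span \<phi> I"
    and on: "\<And>j k. j \<in> J \<Longrightarrow> k \<in> J \<Longrightarrow> sphere_ip (\<psi> j) (\<psi> k) = (if j = k then 1 else 0)"
    and gen: "\<And>i. i \<in> I \<Longrightarrow> \<phi> i \<in> sphere_span \<psi> J"
    using basis by (simp_all add: sphere_orthonormal_basis_def)
  have fin: "finite J" using J insert.hyps finite_subset by blast
  have iJ: "i \<notin> J" using J insert.hyps by auto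
  have cont: "continuous_on (sphere 0 1) (\<phi> k)" if "k \<in> insert i I" for k
    using insert.prems that by blast
  have cont\<psi>: "continuous_on (sphere 0 1) (\<psi> j)" if "j \<in> J" for j
    using span[OF that] by (rule continuous_on_sphere_span[rotated]) (simp add: cont)
  have span': "\<psi> j \<in> sphere_span \<phi> (insert i I)" if "j \<in> J" for j
    using span[OF that] insert.hyps by (intro sphere_span_mono[of "insert i I" I]) auto
  define s where "s x = (\<Sum>j\<in>J. sphere_ip (\<phi> i) (\<psi> j) * \<psi> j x)" for x
  define r where "r x = \<phi> i x - s x" for x
  have s_span: "s \<in> sphere_span \<phi> (insert i I)"
    unfolding s_def[abs_def] by (intro sphere_span_lincomb span')
  have r_span: "r \<in> sphere_span \<phi> (insert i I)"
    unfolding r_def[abs_def]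
    using sphere_span_add[OF sphere_span_base[of "insert i I" i] sphere_span_scale[OF s_span, of "-1"]] insert.hyps
    by simp
  have cont_s: "continuous_on (sphere 0 1) s"
    by (rule continuous_on_sphere_span[OF cont s_span])
  have cont_r: "continuous_on (sphere 0 1) r"
    by (rule continuous_on_sphere_span[OF cont r_span])
  have orth: "sphere_ip r (\<psi> k) = 0" if "k \<in> J" for k
  proof -
    have "sphere_ip s (\<psi> k) = (\<Sum>j\<in>J. sphere_ip (\<phi> i) (\<psi> j) * sphere_ip (\<psi> j) (\<psi> k))"
      unfolding s_def[abs_def] using that by (intro sphere_ip_lincomb cont\<psi>)
    also have "\<dots> = sphere_ip (\<phi> i) (\<psi> k)"
      using fin that by (simp add: on if_distrib[of "\<lambda>c. _ * c"] cong: sum.cong if_cong)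
    finally show ?thesis
      using that by (simp add: r_def[abs_def] sphere_ip_diff cont cont\<psi> cont_s)
  qed
  show ?case
  proof (cases "sphere_ip r r = 0")
    case True
    then have "r x = 0" if "x \<in> sphere 0 1" for x
      using integral_sphere_measure_square_eq_0[OF cont_r _ that] by (simp add: sphere_ip_def power2_eq_square)
    then have "\<phi> i x = s x" if "x \<in> sphere 0 1" for x
      using that by (simp add: r_def)
    moreover have "s \<in> sphere_span \<psi> J"
      unfolding s_def[abs_def] by (intro sphere_span_lincomb sphere_span_base fin)
    ultimately have "\<phi> i \<in> sphere_span \<psi> J"
      by (rule sphere_span_cong[rotated])
    then show ?thesis
      using J span' on gen by (intro exI[of _ J] exI[of _ \<psi>]) (auto simp: sphere_orthonormal_basis_def)
  next
    case False
    define N where "N = sqrt (sphere_ip r r)"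
    have "sphere_ip r r \<ge> 0"
      unfolding sphere_ip_def by (rule Bochner_Integration.integral_nonneg) simp
    with False have N: "N > 0" "N * N = sphere_ip r r"
      by (auto simp: N_def)
    define \<psi>' where "\<psi>' = \<psi>(i := \<lambda>x. (1 / N) * r x)"
    have \<psi>'J: "\<psi>' j = \<psi> j" if "j \<in> J" for j
      using that iJ by (auto simp: \<psi>'_def)
    have \<psi>'i: "\<psi>' i = (\<lambda>x. (1 / N) * r x)"
      by (simp add: \<psi>'_def)
    have ip_i: "sphere_ip (\<psi>' i) g = (1 / N) * sphere_ip r g" for g
      by (simp add: \<psi>'i sphere_ip_def)
    have span_J: "\<psi> j \<in> sphere_span \<psi>' (insert i J)" if "j \<in> J" for j
      using sphere_span_base[of "insert i J" j \<psi>'] that fin by (simp add: \<psi>'J)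
    have "\<phi> k \<in> sphere_span \<psi>' (insert i J)" if k: "k \<in> I" for k
    proof -
      obtain c where c: "\<And>x. x \<in> sphere 0 1 \<Longrightarrow> \<phi> k x = (\<Sum>j\<in>J. c j * \<psi> j x)"
        using gen[OF k] by (auto simp: sphere_span_def)
      show ?thesis
        using sphere_span_lincomb[OF span_J] c by (rule sphere_span_cong)
    qed
    moreover have "\<phi> i \<in> sphere_span \<psi>' (insert i J)"
    proof -
      have "s \<in> sphere_span \<psi>' (insert i J)"
        unfolding s_def[abs_def] by (intro sphere_span_lincomb span_J)
      moreover have "(\<lambda>x. N * \<psi>' i x) \<in> sphere_span \<psi>' (insert i J)"
        using fin by (intro sphere_span_scale sphere_span_base) auto
      ultimately have "(\<lambda>x. s x + N * \<psi>' i x) \<in> sphere_span \<psi>' (insert i J)"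
        by (rule sphere_span_add)
      then show ?thesis
        by (rule sphere_span_cong) (use N in \<open>simp add: \<psi>'i r_def\<close>)
    qed
    moreover have "sphere_ip (\<psi>' j) (\<psi>' k) = (if j = k then 1 else 0)"
      if "j \<in> insert i J" "k \<in> insert i J" for j k
    proof -
      have ii: "sphere_ip (\<psi>' i) (\<psi>' i) = 1"
      proof -
        have "sphere_ip (\<psi>' i) (\<psi>' i) = (1 / N) * ((1 / N) * sphere_ip r r)"
          using ip_i[of "\<psi>' i"] ip_i[of r] sphere_ip_commute[of r "\<psi>' i"] by simp
        then show ?thesis using N False by (simp add: field_simps)
      qed
      have ik: "sphere_ip (\<psi>' i) (\<psi>' k) = 0" "sphere_ip (\<psi>' k) (\<psi>' i) = 0" if "k \<in> J" for k
        using orth[OF that] ip_i[of "\<psi>' k"] sphere_ip_commute[of "\<psi>' k" "\<psi>' i"] \<psi>'J[OF that] by auto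
      show ?thesis
        using that ii ik on iJ by (auto simp: \<psi>'J)
    qed
    moreover have "\<psi>' j \<in> sphere_span \<phi> (insert i I)" if "j \<in> insert i J" for j
      using that sphere_span_scale[OF r_span] span' by (auto simp: \<psi>'J \<psi>'i simp del: times_divide_eq_left)
    ultimately show ?thesis
      using J unfolding sphere_orthonormal_basis_def
      by (intro exI[of _ "insert i J"] exI[of _ \<psi>'] conjI ballI) auto
  qed
qed

text \<open>The reproducing kernel of a rotation invariant function space is constant on the diagonal, and
  its trace is the dimension.\<close>

theorem sphere_span_sup_bound:
  fixes \<phi> :: "'i \<Rightarrow> real ^ 'n \<Rightarrow> real"
  assumes fin: "finite I" and cont: "\<And>i. i \<in> I \<Longrightarrow> continuous_on (sphere 0 1) (\<phi> i)"
    and inv: "\<And>f T. f \<in> sphere_span \<phi> I \<Longrightarrow> orthogonal_transformation T \<Longrightarrow> (\<lambda>x. f (T x)) \<in> sphere_span \<phi> I"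
    and f: "f \<in> sphere_span \<phi> I" and x: "x \<in> sphere 0 1"
  shows "(f x)\<^sup>2 \<le> real (card I) * (\<integral>y. (f y)\<^sup>2 \<partial>sphere_measure)"
proof -
  obtain J \<psi> where basis: "sphere_orthonormal_basis \<phi> I \<psi> J"
    using sphere_gram_schmidt[of I \<phi>] fin cont by blast
  have J: "J \<subseteq> I"
    and span: "\<And>j. j \<in> J \<Longrightarrow> \<psi> j \<in> sphere_span \<phi> I"
    and on: "\<And>j k. j \<in> J \<Longrightarrow> k \<in> J \<Longrightarrow> sphere_ip (\<psi> j) (\<psi> k) = (if j = k then 1 else 0)"
    and gen: "\<And>i. i \<in> I \<Longrightarrow> \<phi> i \<in> sphere_span \<psi> J"
    using basis by (simp_all add: sphere_orthonormal_basis_def)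
  have finJ: "finite J" using J fin finite_subset by blast
  have cont\<psi>: "continuous_on (sphere 0 1) (\<psi> j)" if "j \<in> J" for j
    using span[OF that] cont by (rule continuous_on_sphere_span[rotated])
  \<comment> \<open>The diagonal of the reproducing kernel.\<close>
  define K where "K y = (\<Sum>j\<in>J. (\<psi> j y)\<^sup>2)" for y
  have norm_lincomb: "(\<integral>y. (\<Sum>j\<in>J. c j * \<psi> j y)\<^sup>2 \<partial>sphere_measure) = (\<Sum>j\<in>J. (c j)\<^sup>2)" for c
  proof -
    let ?g = "\<lambda>y. \<Sum>j\<in>J. c j * \<psi> j y"
    have cg: "continuous_on (sphere 0 1) ?g"
      by (intro continuous_intros cont\<psi>)
    have "sphere_ip ?g ?g = (\<Sum>j\<in>J. c j * sphere_ip (\<psi> j) ?g)"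
      by (intro sphere_ip_lincomb cont\<psi> cg)
    also have "\<dots> = (\<Sum>j\<in>J. c j * c j)"
    proof (rule sum.cong[OF refl])
      fix j assume j: "j \<in> J"
      have "sphere_ip (\<psi> j) ?g = (\<Sum>k\<in>J. c k * sphere_ip (\<psi> k) (\<psi> j))"
        unfolding sphere_ip_commute[of "\<psi> j"] using j by (intro sphere_ip_lincomb cont\<psi>)
      also have "\<dots> = c j"
        using finJ j by (simp add: on if_distrib[of "\<lambda>c. _ * c"] cong: sum.cong if_cong)
      finally show "c j * sphere_ip (\<psi> j) ?g = c j * c j" by simp
    qed
    finally show ?thesis by (simp add: sphere_ip_def power2_eq_square)
  qed
  \<comment> \<open>Cauchy-Schwarz for the coefficients of \<open>g\<close> in the orthonormal
    basis.\<close>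
  have bound: "(g y)\<^sup>2 \<le> K y * (\<integral>y. (g y)\<^sup>2 \<partial>sphere_measure)"
    if g: "g \<in> sphere_span \<phi> I" and y: "y \<in> sphere 0 1" for g y
  proof -
    obtain a where a: "\<And>x. x \<in> sphere 0 1 \<Longrightarrow> g x = (\<Sum>i\<in>I. a i * \<phi> i x)"
      using g by (auto simp: sphere_span_def)
    have "g \<in> sphere_span \<psi> J"
      using sphere_span_lincomb[OF gen] a by (rule sphere_span_cong)
    then obtain c where c: "\<And>x. x \<in> sphere 0 1 \<Longrightarrow> g x = (\<Sum>j\<in>J. c j * \<psi> j x)"
      by (auto simp: sphere_span_def)
    have "(\<integral>y. (g y)\<^sup>2 \<partial>sphere_measure) = (\<integral>y. (\<Sum>j\<in>J. c j * \<psi> j y)\<^sup>2 \<partial>sphere_measure)"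
      by (rule Bochner_Integration.integral_cong) (auto simp: c)
    also have "\<dots> = (\<Sum>j\<in>J. (c j)\<^sup>2)"
      by (rule norm_lincomb)
    finally show ?thesis
      using Cauchy_Schwarz_ineq_sum[of c "\<lambda>j. \<psi> j y" J] by (simp add: c[OF y] K_def mult.commute)
  qed
  \<comment> \<open>The kernel section at \<open>y\<close>, rotated so that \<open>y'\<close> is
    sent to \<open>y\<close>, takes the value \<open>K y\<close> at \<open>y'\<close> and has
    squared norm \<open>K y\<close>. The bound at \<open>y'\<close> then reads
    \<open>(K y)^2 <= K y' * K y\<close>.\<close>
  have le: "K y \<le> K y'" if y: "y \<in> sphere 0 1" "y' \<in> sphere 0 1" for y y'
  proof -
    obtain T :: "real ^ 'n \<Rightarrow> real ^ 'n" where T: "orthogonal_transformation T" "T y' = y"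
      by (rule orthogonal_transformation_exists_1[of y' y]) (use y in auto)
    let ?g = "\<lambda>w. \<Sum>j\<in>J. \<psi> j y * \<psi> j w"
    have g: "?g \<in> sphere_span \<phi> I"
      by (intro sphere_span_lincomb span)
    have "(?g (T y'))\<^sup>2 \<le> K y' * (\<integral>w. (?g (T w))\<^sup>2 \<partial>sphere_measure)"
      by (rule bound[OF inv[OF g T(1)] y(2)])
    also have "(\<integral>w. (?g (T w))\<^sup>2 \<partial>sphere_measure) = (\<integral>w. (?g w)\<^sup>2 \<partial>sphere_measure)"
      by (rule integral_sphere_measure_orthogonal[OF T(1), of "\<lambda>w. (?g w)\<^sup>2"]) (intro continuous_intros cont\<psi>)
    also have "\<dots> = K y"
      unfolding norm_lincomb K_def ..
    also have "?g (T y') = K y"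
      by (simp add: T K_def power2_eq_square)
    finally have "K y * K y \<le> K y' * K y" by (simp add: power2_eq_square)
    moreover have "K y \<ge> 0" "K y' \<ge> 0"
      by (simp_all add: K_def sum_nonneg)
    ultimately show ?thesis
      by (cases "K y = 0") auto
  qed
  \<comment> \<open>Total mass 1 turns the constant \<open>K\<close> into its integral, the trace,
    to which each basis function contributes 1.\<close>
  have "K x = (\<integral>y. K x \<partial>(sphere_measure :: (real ^ 'n) measure))"
    by (rule integral_sphere_measure_const[symmetric])
  also have "\<dots> = (\<integral>y. K y \<partial>sphere_measure)"
    by (rule Bochner_Integration.integral_cong) (use x in \<open>auto intro!: antisym le\<close>)
  also have "\<dots> = (\<Sum>j\<in>J. sphere_ip (\<psi> j) (\<psi> j))"
    unfolding K_def sphere_ip_def power2_eq_square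
    by (intro Bochner_Integration.integral_sum integrable_sphere_measure continuous_intros cont\<psi>)
  also have "\<dots> = real (card J)"
    by (simp add: on)
  finally have "K x \<le> real (card I)"
    using card_mono[OF fin J] by simp
  moreover have "(\<integral>y. (f y)\<^sup>2 \<partial>sphere_measure) \<ge> 0"
    by (rule Bochner_Integration.integral_nonneg) simp
  ultimately show ?thesis
    using bound[OF f x] by (meson mult_right_mono order_trans)
qed

section \<open>Homogeneous polynomials\<close>

definition exponents :: "nat \<Rightarrow> ('n::finite \<Rightarrow> nat) set" where
  "exponents k = {\<alpha>. sum \<alpha> UNIV = k}"

lemma finite_exponents_le: "finite {\<alpha>::'n::finite \<Rightarrow> nat. sum \<alpha> UNIV \<le> t}"
proof (rule finite_subset)
  show "{\<alpha>::'n \<Rightarrow> nat. sum \<alpha> UNIV \<le> t} \<subseteq> Pi\<^sub>E UNIV (\<lambda>_. {..t})"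
  proof
    fix \<alpha> :: "'n \<Rightarrow> nat" assume "\<alpha> \<in> {\<alpha>. sum \<alpha> UNIV \<le> t}"
    moreover have "\<alpha> i \<le> sum \<alpha> UNIV" for i by (rule member_le_sum) auto
    ultimately show "\<alpha> \<in> Pi\<^sub>E UNIV (\<lambda>_. {..t})" by (auto intro: order_trans)
  qed
  show "finite (Pi\<^sub>E (UNIV::'n set) (\<lambda>_. {..t}))" by (intro finite_PiE) auto
qed

lemma finite_exponents: "finite (exponents k)"
  unfolding exponents_def by (rule finite_subset[OF _ finite_exponents_le[of k]]) auto

text \<open>Stars and bars: listing the exponents along an enumeration of the index type gives lists
  of fixed length and sum.\<close>

lemma card_exponents_le: "card (exponents k :: ('n::finite \<Rightarrow> nat) set) \<le> (k + CARD('n) - 1) choose k"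
proof -
  obtain xs :: "'n list" where xs: "set xs = UNIV" "distinct xs"
    using finite_distinct_list[of "UNIV :: 'n set"] by auto
  have len: "length xs = CARD('n)" using distinct_card[OF xs(2)] xs(1) by simp
  have "card (exponents k :: ('n \<Rightarrow> nat) set) \<le> card {l::nat list. length l = CARD('n) \<and> sum_list l = k}"
  proof (rule card_inj_on_le[where f = "\<lambda>\<alpha>. map \<alpha> xs"])
    show "inj_on (\<lambda>\<alpha>::'n \<Rightarrow> nat. map \<alpha> xs) (exponents k)"
      by (rule inj_onI) (use xs in \<open>auto simp: fun_eq_iff\<close>)
    show "(\<lambda>\<alpha>::'n \<Rightarrow> nat. map \<alpha> xs) ` exponents k \<subseteq> {l. length l = CARD('n) \<and> sum_list l = k}"
      using xs by (auto simp: exponents_def len sum_list_distinct_conv_sum_set)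
    show "finite {l::nat list. length l = CARD('n) \<and> sum_list l = k}"
      by (rule finite_subset[OF _ finite_lists_length_eq[of "{..k}" "CARD('n)"]])
        (auto simp: member_le_sum_list)
  qed
  then show ?thesis by (simp only: card_length_sum_list)
qed

text \<open>Unlike in \<open>sphere_span\<close>, equality holds on the whole space, as membership
  in \<open>poly_space\<close> requires.\<close>

definition hom_space :: "nat \<Rightarrow> (real ^ 'n \<Rightarrow> real) set" where
  "hom_space k = {f. \<exists>c. \<forall>x. f x = (\<Sum>\<alpha>\<in>exponents k. c \<alpha> * monomial_fun \<alpha> x)}"

lemma hom_space_lincomb:
  assumes "\<And>j. j \<in> J \<Longrightarrow> f j \<in> hom_space k"
  shows "(\<lambda>x. \<Sum>j\<in>J. c j * f j x) \<in> hom_space k"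
proof -
  have "\<forall>j\<in>J. \<exists>a. \<forall>x. f j x = (\<Sum>\<alpha>\<in>exponents k. a \<alpha> * monomial_fun \<alpha> x)"
    using assms by (auto simp: hom_space_def)
  then obtain a where a: "\<And>j x. j \<in> J \<Longrightarrow> f j x = (\<Sum>\<alpha>\<in>exponents k. a j \<alpha> * monomial_fun \<alpha> x)"
    by metis
  have "(\<Sum>j\<in>J. c j * f j x) = (\<Sum>\<alpha>\<in>exponents k. (\<Sum>j\<in>J. c j * a j \<alpha>) * monomial_fun \<alpha> x)" for x
  proof -
    have "(\<Sum>j\<in>J. c j * f j x) = (\<Sum>j\<in>J. \<Sum>\<alpha>\<in>exponents k. c j * a j \<alpha> * monomial_fun \<alpha> x)"
      by (intro sum.cong) (simp_all add: a sum_distrib_left mult.assoc)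
    also have "\<dots> = (\<Sum>\<alpha>\<in>exponents k. \<Sum>j\<in>J. c j * a j \<alpha> * monomial_fun \<alpha> x)"
      by (rule sum.swap)
    finally show ?thesis by (simp add: sum_distrib_right)
  qed
  then show ?thesis
    unfolding hom_space_def by (intro CollectI exI[of _ "\<lambda>\<alpha>. \<Sum>j\<in>J. c j * a j \<alpha>"]) auto
qed

lemma monomial_fun_hom_space:
  assumes "sum \<alpha> UNIV = k"
  shows "monomial_fun \<alpha> \<in> hom_space k"
proof -
  have "\<alpha> \<in> exponents k"
    using assms by (simp add: exponents_def)
  then show ?thesis
    unfolding hom_space_def
    by (intro CollectI exI[of _ "\<lambda>\<beta>. if \<beta> = \<alpha> then 1 else 0"])
      (simp add: if_distrib[of "\<lambda>c. c * _"] finite_exponents cong: if_cong)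
qed

lemma monomial_fun_coord_mult:
  "x $ i * monomial_fun \<alpha> x = monomial_fun (\<alpha>(i := Suc (\<alpha> i))) x"
  unfolding monomial_fun_def by (simp add: prod.remove[of UNIV i] mult.assoc)

lemma sum_fun_upd_Suc:
  fixes \<alpha> :: "'n::finite \<Rightarrow> nat"
  shows "sum (\<alpha>(i := Suc (\<alpha> i))) UNIV = Suc (sum \<alpha> UNIV)"
  by (simp add: sum.remove[of UNIV i])

lemma hom_space_coord_mult:
  assumes "f \<in> hom_space k"
  shows "(\<lambda>x. x $ i * f x) \<in> hom_space (Suc k)"
proof -
  obtain c where c: "\<And>x. f x = (\<Sum>\<alpha>\<in>exponents k. c \<alpha> * monomial_fun \<alpha> x)"
    using assms by (auto simp: hom_space_def)
  have "(\<lambda>x. x $ i * f x) = (\<lambda>x. \<Sum>\<alpha>\<in>exponents k. c \<alpha> * monomial_fun (\<alpha>(i := Suc (\<alpha> i))) x)"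
    by (simp add: c sum_distrib_left mult.left_commute monomial_fun_coord_mult)
  also have "\<dots> \<in> hom_space (Suc k)"
    by (intro hom_space_lincomb monomial_fun_hom_space) (simp only: sum_fun_upd_Suc, simp add: exponents_def)
  finally show ?thesis .
qed

lemma hom_space_inner_mult:
  assumes "f \<in> hom_space k"
  shows "(\<lambda>x. (u \<bullet> x) * f x) \<in> hom_space (Suc k)"
proof -
  have "(\<lambda>x. (u \<bullet> x) * f x) = (\<lambda>x. \<Sum>j\<in>UNIV. u $ j * (x $ j * f x))"
    by (simp add: inner_vec_def sum_distrib_right mult.assoc)
  also have "\<dots> \<in> hom_space (Suc k)"
    using hom_space_coord_mult[OF assms] by (intro hom_space_lincomb)
  finally show ?thesis .
qed

lemma hom_space_norm_mult:
  assumes "f \<in> hom_space k"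
  shows "(\<lambda>x. (x \<bullet> x) * f x) \<in> hom_space (Suc (Suc k))"
proof -
  have "(\<lambda>x. (x \<bullet> x) * f x) = (\<lambda>x. \<Sum>j\<in>UNIV. 1 * (x $ j * (x $ j * f x)))"
    by (simp add: inner_vec_def sum_distrib_right mult.assoc)
  also have "\<dots> \<in> hom_space (Suc (Suc k))"
    using hom_space_coord_mult[OF hom_space_coord_mult[OF assms]] by (intro hom_space_lincomb)
  finally show ?thesis .
qed

lemma hom_space_inner_power:
  fixes u :: "real ^ 'n"
  shows "(\<lambda>x. (u \<bullet> x) ^ k) \<in> hom_space k"
proof (induction k)
  case 0
  have "(\<lambda>x::real^'n. (u \<bullet> x) ^ 0) = monomial_fun (\<lambda>_. 0)"
    by (simp add: monomial_fun_def fun_eq_iff)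
  then show ?case by (simp add: monomial_fun_hom_space)
next
  case (Suc k)
  then show ?case using hom_space_inner_mult[OF Suc, of u] by simp
qed

text \<open>A coordinate of \<open>T x\<close> is the linear form
  \<open>adjoint T (axis i 1) \<bullet> x\<close>; one such factor is split off in each induction
  step.\<close>

lemma monomial_fun_comp_linear:
  fixes T :: "real ^ 'n \<Rightarrow> real ^ 'n"
  assumes T: "linear T"
  shows "sum \<alpha> UNIV = k \<Longrightarrow> (\<lambda>x. monomial_fun \<alpha> (T x)) \<in> hom_space k"
proof (induction k arbitrary: \<alpha>)
  case 0
  then have "monomial_fun \<alpha> = (\<lambda>x. 1)" by (simp add: monomial_fun_def fun_eq_iff)
  then show ?case using hom_space_inner_power[of 0 0] by simp
next
  case (Suc k)
  then obtain i where i: "\<alpha> i \<noteq> 0"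
    by (metis nat.distinct(1) sum.neutral)
  define \<beta> where "\<beta> = \<alpha>(i := \<alpha> i - 1)"
  have \<alpha>: "\<alpha> = \<beta>(i := Suc (\<beta> i))"
    using i by (auto simp: \<beta>_def)
  then have "sum \<beta> UNIV = k"
    using Suc.prems sum_fun_upd_Suc[of \<beta> i] by simp
  then have IH: "(\<lambda>x. monomial_fun \<beta> (T x)) \<in> hom_space k" by (rule Suc.IH)
  have "T x $ i = adjoint T (axis i 1) \<bullet> x" for x
    by (metis adjoint_works[OF T] inner_axis' inner_commute mult_1 inner_real_def)
  then have "(\<lambda>x. monomial_fun \<alpha> (T x)) = (\<lambda>x. (adjoint T (axis i 1) \<bullet> x) * monomial_fun \<beta> (T x))"
    by (subst \<alpha>) (simp flip: monomial_fun_coord_mult)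
  then show ?case using hom_space_inner_mult[OF IH] by simp
qed

text \<open>On the sphere these two degrees already generate all polynomials of degree at most
  \<open>t\<close>, and their monomial counts are the two binomials in
  \<open>dim_Pi\<close>.\<close>

definition top_exponents :: "nat \<Rightarrow> ('n::finite \<Rightarrow> nat) set" where
  "top_exponents t = exponents t \<union> exponents (t - 1)"

lemma finite_top_exponents: "finite (top_exponents t)"
  by (simp add: top_exponents_def finite_exponents)

lemma card_top_exponents_le:
  assumes "CARD('n::finite) = d + 1"
  shows "card (top_exponents t :: ('n \<Rightarrow> nat) set) \<le> dim_Pi d t"
proof (cases "t = 0")
  \<comment> \<open>Here \<open>t - 1\<close> is truncated, so both sets of exponents coincide and
    have one element.\<close>
  case True
  then show ?thesis
    using card_exponents_le[where 'n = 'n, of 0] by (simp add: top_exponents_def dim_Pi_def)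
next
  case False
  have "card (top_exponents t :: ('n \<Rightarrow> nat) set)
      \<le> card (exponents t :: ('n \<Rightarrow> nat) set) + card (exponents (t - 1) :: ('n \<Rightarrow> nat) set)"
    unfolding top_exponents_def by (rule card_Un_le)
  also have "\<dots> \<le> dim_Pi d t"
    unfolding dim_Pi_def using False assms
      card_exponents_le[where 'n = 'n, of t] card_exponents_le[where 'n = 'n, of "t - 1"]
    by (intro add_mono) (auto simp: add_ac)
  finally show ?thesis .
qed

lemma hom_space_sphere_span:
  assumes "k = t \<or> k = t - 1" "f \<in> hom_space k"
  shows "f \<in> sphere_span monomial_fun (top_exponents t)"
proof -
  have "f \<in> sphere_span monomial_fun (exponents k)"
    using assms(2) by (auto simp: hom_space_def sphere_span_def)
  then show ?thesis
    by (rule sphere_span_mono[OF finite_top_exponents, rotated]) (use assms(1) in \<open>auto simp: top_exponents_def\<close>)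
qed

text \<open>On the sphere, multiplying by \<open>|x|\<^sup>2\<close> raises the degree of homogeneity without changing values.\<close>

lemma hom_space_sphere_span_le:
  assumes "k \<le> t" "f \<in> hom_space k"
  shows "f \<in> sphere_span monomial_fun (top_exponents t)"
  using assms
proof (induction "t - k" arbitrary: k f rule: less_induct)
  case less
  show ?case
  proof (cases "k = t \<or> k = t - 1")
    case True
    then show ?thesis using less.prems by (intro hom_space_sphere_span)
  next
    case False
    \<comment> \<open>Now \<open>k + 2 <= t\<close>. Steps of two end at \<open>t\<close> or
      \<open>t - 1\<close>, according to the parity of \<open>k\<close>.\<close>
    then have "(\<lambda>x. (x \<bullet> x) * f x) \<in> sphere_span monomial_fun (top_exponents t)"
      using less.prems by (intro less.hyps[of "Suc (Suc k)"] hom_space_norm_mult) auto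
    then show ?thesis
      by (rule sphere_span_cong) (simp add: dot_square_norm)
  qed
qed

lemma zonal_poly_sphere_span:
  assumes "degree q \<le> t"
  shows "(\<lambda>x. poly q (z \<bullet> x)) \<in> sphere_span monomial_fun (top_exponents t)"
  unfolding poly_altdef using assms
  by (intro sphere_span_lincomb hom_space_sphere_span_le[OF _ hom_space_inner_power]) auto

lemma sphere_span_top_exponents_invariant:
  fixes T :: "real ^ 'n \<Rightarrow> real ^ 'n"
  assumes f: "f \<in> sphere_span monomial_fun (top_exponents t)" and T: "orthogonal_transformation T"
  shows "(\<lambda>x. f (T x)) \<in> sphere_span monomial_fun (top_exponents t)"
proof -
  obtain c where c: "\<And>x. x \<in> sphere 0 1 \<Longrightarrow> f x = (\<Sum>\<alpha>\<in>top_exponents t. c \<alpha> * monomial_fun \<alpha> x)"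
    using f by (auto simp: sphere_span_def)
  have "(\<lambda>x. \<Sum>\<alpha>\<in>top_exponents t. c \<alpha> * monomial_fun \<alpha> (T x)) \<in> sphere_span monomial_fun (top_exponents t)"
  proof (rule sphere_span_lincomb)
    fix \<alpha> :: "'n \<Rightarrow> nat" assume "\<alpha> \<in> top_exponents t"
    then have "sum \<alpha> UNIV = t \<or> sum \<alpha> UNIV = t - 1"
      by (auto simp: top_exponents_def exponents_def)
    then show "(\<lambda>x. monomial_fun \<alpha> (T x)) \<in> sphere_span monomial_fun (top_exponents t)"
      by (rule hom_space_sphere_span)
        (rule monomial_fun_comp_linear[OF orthogonal_transformation_linear[OF T] refl])
  qed
  then show ?thesis
    by (rule sphere_span_cong) (simp add: c orthogonal_transformation_norm[OF T])
qed

lemma continuous_on_monomial_fun: "continuous_on S (monomial_fun \<alpha>)"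
  unfolding monomial_fun_def by (intro continuous_intros)

lemma zonal_poly_sup_bound:
  fixes z x :: "real ^ 'n"
  assumes "CARD('n) = d + 1" "degree q \<le> t" "x \<in> sphere 0 1"
  shows "(poly q (z \<bullet> x))\<^sup>2 \<le> real (dim_Pi d t) * (\<integral>y. (poly q (z \<bullet> y))\<^sup>2 \<partial>sphere_measure)"
proof -
  have "(poly q (z \<bullet> x))\<^sup>2
      \<le> real (card (top_exponents t :: ('n \<Rightarrow> nat) set)) * (\<integral>y. (poly q (z \<bullet> y))\<^sup>2 \<partial>sphere_measure)"
    using zonal_poly_sphere_span[OF assms(2)] assms(3)
    by (rule sphere_span_sup_bound[where \<phi> = monomial_fun, rotated 3])
      (auto intro: finite_top_exponents continuous_on_monomial_fun sphere_span_top_exponents_invariant)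
  also have "\<dots> \<le> real (dim_Pi d t) * (\<integral>y. (poly q (z \<bullet> y))\<^sup>2 \<partial>sphere_measure)"
    using card_top_exponents_le[OF assms(1), of t]
    by (intro mult_right_mono Bochner_Integration.integral_nonneg) auto
  finally show ?thesis .
qed

section \<open>Membership of the test functions in \<open>poly_space\<close>\<close>

lemma hom_space_poly_space:
  assumes "k \<le> t" "f \<in> hom_space k"
  shows "f \<in> poly_space t"
proof -
  obtain c where c: "\<And>x. f x = (\<Sum>\<alpha>\<in>exponents k. c \<alpha> * monomial_fun \<alpha> x)"
    using assms(2) by (auto simp: hom_space_def)
  have "f x = (\<Sum>\<alpha>\<in>{\<alpha>. sum \<alpha> UNIV \<le> t}. (if \<alpha> \<in> exponents k then c \<alpha> else 0) * monomial_fun \<alpha> x)" for x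
    unfolding c using assms(1)
    by (intro sum.mono_neutral_cong_left finite_exponents_le) (auto simp: exponents_def)
  then show ?thesis
    unfolding poly_space_def
    by (intro CollectI exI[of _ "\<lambda>\<alpha>. if \<alpha> \<in> exponents k then c \<alpha> else 0"] allI)
qed

lemma poly_space_lincomb:
  fixes f :: "'i \<Rightarrow> real ^ 'n \<Rightarrow> real"
  assumes "\<And>j. j \<in> J \<Longrightarrow> f j \<in> poly_space t"
  shows "(\<lambda>x. \<Sum>j\<in>J. c j * f j x) \<in> poly_space t"
proof -
  let ?E = "{\<alpha>::'n \<Rightarrow> nat. sum \<alpha> UNIV \<le> t}"
  have "\<forall>j\<in>J. \<exists>a. \<forall>x. f j x = (\<Sum>\<alpha>\<in>?E. a \<alpha> * monomial_fun \<alpha> x)"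
    using assms by (auto simp: poly_space_def)
  from bchoice[OF this] obtain a where a: "\<forall>j\<in>J. \<forall>x. f j x = (\<Sum>\<alpha>\<in>?E. a j \<alpha> * monomial_fun \<alpha> x)"
    by blast
  have "(\<Sum>j\<in>J. c j * f j x) = (\<Sum>\<alpha>\<in>?E. (\<Sum>j\<in>J. c j * a j \<alpha>) * monomial_fun \<alpha> x)" for x
  proof -
    have "(\<Sum>j\<in>J. c j * f j x) = (\<Sum>j\<in>J. \<Sum>\<alpha>\<in>?E. c j * a j \<alpha> * monomial_fun \<alpha> x)"
      by (intro sum.cong) (simp_all add: a sum_distrib_left mult.assoc)
    also have "\<dots> = (\<Sum>\<alpha>\<in>?E. \<Sum>j\<in>J. c j * a j \<alpha> * monomial_fun \<alpha> x)"
      by (rule sum.swap)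
    finally show ?thesis by (simp add: sum_distrib_right)
  qed
  then show ?thesis
    unfolding poly_space_def by (intro CollectI exI[of _ "\<lambda>\<alpha>. \<Sum>j\<in>J. c j * a j \<alpha>"]) auto
qed

lemma zonal_poly_poly_space:
  assumes "degree q \<le> t"
  shows "(\<lambda>x. poly q (z \<bullet> x)) \<in> poly_space t"
  unfolding poly_altdef using assms
  by (intro poly_space_lincomb hom_space_poly_space[OF _ hom_space_inner_power]) auto

lemma coord_mult_zonal_poly_poly_space:
  assumes "degree q < t"
  shows "(\<lambda>x. (x $ i - b) * poly q (z \<bullet> x)) \<in> poly_space t"
proof -
  have "(\<lambda>x. x $ i * poly q (z \<bullet> x)) = (\<lambda>x. \<Sum>j\<le>degree q. coeff q j * (x $ i * (z \<bullet> x) ^ j))"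
    by (simp add: poly_altdef sum_distrib_left mult_ac)
  also have "\<dots> \<in> poly_space t"
    using assms
    by (intro poly_space_lincomb hom_space_poly_space[OF _ hom_space_coord_mult[OF hom_space_inner_power]]) auto
  finally have 1: "(\<lambda>x. x $ i * poly q (z \<bullet> x)) \<in> poly_space t" .
  have 2: "(\<lambda>x. poly q (z \<bullet> x)) \<in> poly_space t"
    using assms by (intro zonal_poly_poly_space) simp
  \<comment> \<open>A difference written as a sum over two truth values, to fit
    \<open>poly_space_lincomb\<close>.\<close>
  have "(\<lambda>x. \<Sum>s\<in>{True, False}. (if s then 1 else - b) *
      (if s then \<lambda>x. x $ i * poly q (z \<bullet> x) else (\<lambda>x. poly q (z \<bullet> x))) x) \<in> poly_space t"
    using 1 2 by (intro poly_space_lincomb) auto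
  then show ?thesis by (simp add: left_diff_distrib)
qed

section \<open>The cap estimate\<close>

text \<open>On \<open>[0, pi/3]\<close> the cosine is at least \<open>1/2\<close>, so
  \<open>sin y >= y/2\<close> there. Hence
  \<open>1 - cos R >= 1 - cos (2R/3) = 2 sin^2 (R/3) >= 2 (R/6)^2\<close>.\<close>

lemma one_minus_cos_ge:
  assumes "0 \<le> R" "R \<le> pi"
  shows "1 - cos R \<ge> R\<^sup>2 / 18"
proof -
  have "sin (R / 3) - (R / 3) / 2 \<ge> sin 0 - 0 / 2"
  proof (rule DERIV_nonneg_imp_nondecreasing[where f = "\<lambda>y. sin y - y / 2"])
    fix y assume y: "0 \<le> y" "y \<le> R / 3"
    then have "cos (pi / 3) \<le> cos y"
      using assms by (intro cos_monotone_0_pi_le) auto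
    then have "cos y - 1 / 2 \<ge> 0"
      by (simp add: cos_60)
    moreover have "((\<lambda>y. sin y - y / 2) has_real_derivative cos y - 1 / 2) (at y)"
      by (auto intro!: derivative_eq_intros)
    ultimately show "\<exists>D. ((\<lambda>y. sin y - y / 2) has_real_derivative D) (at y) \<and> 0 \<le> D"
      by blast
  qed (use assms in simp)
  then have "sin (R / 3) \<ge> R / 6" by simp
  then have "(sin (R / 3))\<^sup>2 \<ge> (R / 6)\<^sup>2"
    using assms by (intro power_mono) auto
  moreover have "cos (2 * (R / 3)) = 1 - 2 * (sin (R / 3))\<^sup>2"
    by (rule cos_double_sin)
  moreover have "cos R \<le> cos (2 * (R / 3))"
    using assms by (intro cos_monotone_0_pi_le) auto
  ultimately show ?thesis
    by (simp add: power_divide)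
qed

text \<open>The factor \<open>128 = 8 * 64 * 1/4\<close> comes from
  \<open>pi * M_const d >= 8\<close>, from \<open>2^6\<close>, and from the bound \<open>1/4\<close>
  for \<open>2^(d/2) (sqrt d / e)^d\<close>.\<close>

lemma V_const_ge:
  fixes d :: nat
  assumes "d \<ge> 1" "0 < \<epsilon>" "\<epsilon> < 1" "0 < a" "a \<le> A"
  shows "V_const d a A \<epsilon> \<ge> (A / a) / (1 - \<epsilon>) * (128 * (real d)\<^sup>2)"
proof -
  define Q where "Q = (A / a) / (1 - \<epsilon>)"
  have d: "real d > 0" using assms by simp
  have Q: "Q \<ge> 0" using assms by (simp add: Q_def)
  have e: "2 \<le> exp (1::real)" "exp (1::real) \<le> 3"
    using exp_ge_add_one_self[of 1] exp_le by auto
  have "pi * M_const d = 2 * exp 1 * (2 + sqrt (real d ^ 2 / 2 - real d + 1))"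
    by (simp add: M_const_def)
  also have "\<dots> \<ge> 2 * 2 * (2 + 0)"
  proof (intro mult_mono add_mono)
    have "real d ^ 2 / 2 - real d + 1 \<ge> 0"
      using zero_le_power2[of "real d - 1"] by (simp add: power2_diff)
    then show "0 \<le> sqrt (real d ^ 2 / 2 - real d + 1)" by simp
  qed (use e in auto)
  finally have M: "pi * M_const d \<ge> 8" by simp
  \<comment> \<open>The last factor is \<open>exp ((d/2) (ln (2d) - 2))\<close>. The inequality
    \<open>ln x >= 1 - 1/x\<close> at \<open>x = 2d/e\<close> is sharp at the real minimizer
    \<open>2d = e\<close> and bounds the exponent by \<open>-e/4\<close>.\<close>
  have "1 - exp 1 / (2 * real d) \<le> ln (2 * real d / exp 1)"
    using ln_le_minus_one[of "exp 1 / (2 * real d)"] d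
    by (simp add: ln_div)
  then have "2 - exp 1 / (2 * real d) \<le> ln 2 + ln (real d)"
    using d by (simp add: ln_div ln_mult)
  then have "real d / 2 * (2 - exp 1 / (2 * real d)) \<le> real d / 2 * (ln 2 + ln (real d))"
    by (intro mult_left_mono) auto
  moreover have "real d / 2 * (2 - exp 1 / (2 * real d)) = real d - exp 1 / 4"
    using d by (simp add: field_simps)
  ultimately have expo: "- exp 1 / 4 \<le> real d / 2 * ln 2 + real d * (ln (real d) / 2 - 1)"
    by (simp add: algebra_simps)
  have "(sqrt (real d) / exp 1) ^ d = exp (ln (real d) / 2 - 1) ^ d"
    using d by (simp add: exp_diff ln_sqrt[symmetric])
  also have "\<dots> = exp (real d * (ln (real d) / 2 - 1))"
    by (rule exp_of_nat_mult[symmetric])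
  finally have "2 powr (real d / 2) * (sqrt (real d) / exp 1) ^ d
      = exp (real d / 2 * ln 2 + real d * (ln (real d) / 2 - 1))"
    by (simp add: powr_def exp_add)
  also have "\<dots> \<ge> exp (- exp 1 / 4)" using expo by simp
  also have "exp (- exp 1 / 4) \<ge> 1 + (- exp 1 / 4 :: real)"
    by (rule exp_ge_add_one_self)
  finally have P: "2 powr (real d / 2) * (sqrt (real d) / exp 1) ^ d \<ge> 1 / 4"
    using e by simp
  have "V_const d a A \<epsilon> = Q * ((pi * M_const d) * (real d)\<^sup>2 * 64 * (2 powr (real d / 2) * (sqrt (real d) / exp 1) ^ d))"
    by (simp add: V_const_def Q_def powr_add powr_numeral)
  also have "\<dots> \<ge> Q * (8 * (real d)\<^sup>2 * 64 * (1 / 4))"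
    using M P Q by (intro mult_left_mono mult_mono mult_right_mono) auto
  finally show ?thesis by (simp add: Q_def)
qed

text \<open>The last inequality is the tail estimate
  \<open>A E / (1 - cos R) <= (1 - \<epsilon>) a F\<close> after inserting the exact ratio
  \<open>E / F\<close> of the localized polynomial.\<close>

lemma radius_bounds:
  fixes d t :: nat and a A \<epsilon> R :: real
  assumes d: "d \<ge> 1" and t: "t \<ge> 1" and eps: "0 < \<epsilon>" "\<epsilon> < 1" and aA: "0 < a" "a \<le> A"
    and R: "V_const d a A \<epsilon> / real t \<le> R" "R \<le> pi"
  shows "0 < R" "t \<ge> 2"
    and "A * (real d * (real d + 4))
      \<le> (1 - \<epsilon>) * a * (1 - cos R) * (4 * (real t * (real t + real d - 1)) + (real d)\<^sup>2 - 2 * real d)"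
proof -
  define Q where "Q = (A / a) / (1 - \<epsilon>)"
  have "A / a \<ge> 1 - \<epsilon>" using aA eps by (simp add: field_simps) (smt (verit) mult_pos_pos)
  then have Q: "Q \<ge> 1"
    unfolding Q_def using eps by (subst le_divide_eq_1_pos) auto
  have d2: "(real d)\<^sup>2 \<ge> 1" using d by (simp add: power2_eq_square mult_ge1_I)
  have "V_const d a A \<epsilon> \<le> R * real t"
    using R t by (simp add: field_simps)
  then have Rt: "R * real t \<ge> Q * (128 * (real d)\<^sup>2)"
    using V_const_ge[OF d eps aA] by (simp add: Q_def)
  have Qd: "Q * (128 * (real d)\<^sup>2) \<ge> 1 * (128 * 1)"
    using Q d2 by (intro mult_mono) auto
  then have Rt128: "R * real t \<ge> 128" using Rt by simp
  then show "0 < R" using t by (smt (verit) mult_nonpos_nonneg of_nat_0_le_iff)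
  \<comment> \<open>For \<open>t = 1\<close> the radius would be at least 128, beyond
    \<open>pi\<close>.\<close>
  have "t \<noteq> 1"
    using Rt128 R(2) pi_less_4 by auto
  then show "t \<ge> 2" using t by simp
  have "1 - cos R \<ge> R\<^sup>2 / 18"
    using R(2) \<open>0 < R\<close> by (intro one_minus_cos_ge) auto
  \<comment> \<open>Since \<open>d^2 - 2 d = (d - 1)^2 - 1\<close>, the left side is at least
    \<open>4 t^2 - 1\<close>.\<close>
  moreover have lam: "4 * (real t * (real t + real d - 1)) + (real d)\<^sup>2 - 2 * real d \<ge> 3 * (real t)\<^sup>2"
  proof -
    have "real t * (real t + real d - 1) \<ge> real t * real t"
      using d by (intro mult_left_mono) auto
    moreover have "(real d - 1)\<^sup>2 \<ge> 0" by simp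
    moreover have "(real t)\<^sup>2 \<ge> 1" using t by (simp add: power2_eq_square mult_ge1_I)
    ultimately show ?thesis by (simp add: power2_eq_square algebra_simps)
  qed
  ultimately have "(1 - cos R) * (4 * (real t * (real t + real d - 1)) + (real d)\<^sup>2 - 2 * real d)
      \<ge> R\<^sup>2 / 18 * (3 * (real t)\<^sup>2)"
    by (intro mult_mono) auto
  also have "R\<^sup>2 / 18 * (3 * (real t)\<^sup>2) = (R * real t)\<^sup>2 / 6"
    by (simp add: power_mult_distrib)
  \<comment> \<open>Only one of the two factors keeps \<open>Q\<close>, because
    \<open>A = (1 - \<epsilon>) a Q\<close> is linear in \<open>Q\<close>; the other is bounded by
    128.\<close>
  also have "(R * real t)\<^sup>2 / 6 \<ge> (Q * (128 * (real d)\<^sup>2)) * 128 / 6"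
    unfolding power2_eq_square[of "R * real t"]
    by (intro divide_right_mono mult_mono[OF Rt Rt128]) (use Rt128 in auto)
  finally have "(1 - cos R) * (4 * (real t * (real t + real d - 1)) + (real d)\<^sup>2 - 2 * real d)
      \<ge> (Q * (128 * (real d)\<^sup>2)) * 128 / 6"
    by simp
  also have "(Q * (128 * (real d)\<^sup>2)) * 128 / 6 \<ge> Q * (real d * (real d + 4))"
  proof -
    have "real d * (real d + 4) \<le> 5 * (real d)\<^sup>2"
      using d by (simp add: power2_eq_square algebra_simps)
    also have "\<dots> \<le> 128 * 128 / 6 * (real d)\<^sup>2"
      by (intro mult_right_mono) auto
    finally have "Q * (real d * (real d + 4)) \<le> Q * (128 * 128 / 6 * (real d)\<^sup>2)"
      using Q by (intro mult_left_mono) auto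
    then show ?thesis by simp
  qed
  finally have "(1 - \<epsilon>) * a * (Q * (real d * (real d + 4)))
      \<le> (1 - \<epsilon>) * a * ((1 - cos R) * (4 * (real t * (real t + real d - 1)) + (real d)\<^sup>2 - 2 * real d))"
    using eps aA by (intro mult_left_mono) auto
  moreover have "(1 - \<epsilon>) * a * Q = A"
    using eps aA by (simp add: Q_def)
  ultimately show "A * (real d * (real d + 4))
      \<le> (1 - \<epsilon>) * a * (1 - cos R) * (4 * (real t * (real t + real d - 1)) + (real d)\<^sup>2 - 2 * real d)"
    by (simp add: mult.assoc[symmetric])
qed

lemma pearson_functional_zonal_integral:
  fixes i :: "'n::finite"
  assumes "CARD('n) = d + 1" "d \<ge> 1"
  shows "pearson_functional (zonal_integral i) d"
  using assms(2)
  by unfold_locales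
    (simp_all add: zonal_integral_add zonal_integral_smult zonal_integral_pearson[OF assms(1)] zonal_integral_reflect
      del: mult_pCons_left)

text \<open>With a second coordinate available, every \<open>s\<close> in \<open>[0, 1]\<close> is
  the \<open>i\<close>-th coordinate of a point of the sphere; a zero integral would give
  \<open>q\<close> infinitely many roots.\<close>

lemma zonal_integral_square_pos:
  fixes i :: "'n::finite"
  assumes "CARD('n) \<ge> 2" "q \<noteq> 0"
  shows "zonal_integral i (q\<^sup>2) > 0"
proof (rule ccontr)
  assume "\<not> zonal_integral i (q\<^sup>2) > 0"
  moreover have "zonal_integral i (q\<^sup>2) \<ge> 0"
    unfolding zonal_integral_def by (rule Bochner_Integration.integral_nonneg) simp
  ultimately have "zonal_integral i (q\<^sup>2) = 0"
    by linarith
  then have 0: "(\<integral>y. (poly q (y $ i))\<^sup>2 \<partial>(sphere_measure :: (real ^ 'n) measure)) = 0"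
    by (simp add: zonal_integral_def)
  have "UNIV \<noteq> {i}"
    using assms(1) by (auto dest: arg_cong[of _ _ card])
  then obtain j where j: "j \<noteq> i"
    by blast
  have "poly q s = 0" if s: "s \<in> {0..1}" for s
  proof -
    define y where "y = s *\<^sub>R axis i 1 + sqrt (1 - s\<^sup>2) *\<^sub>R axis j (1::real)"
    have s2: "s\<^sup>2 \<le> 1" using s by (simp add: power_le_one)
    have "y \<bullet> y = 1"
      using j s2 by (simp add: y_def inner_add_left inner_add_right inner_axis_axis power2_eq_square[symmetric])
    then have "y \<in> sphere 0 1" by (simp add: norm_eq_1)
    moreover have "continuous_on (sphere 0 1) (\<lambda>y::real^'n. poly q (y $ i))"
      by (intro continuous_intros)
    ultimately have "poly q (y $ i) = 0"
      using integral_sphere_measure_square_eq_0[OF _ 0] by simp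
    moreover have "y $ i = s" using j by (simp add: y_def axis_def)
    ultimately show ?thesis by simp
  qed
  then have "{0..1::real} \<subseteq> {s. poly q s = 0}" by auto
  then have "finite {0..1::real}"
    using poly_roots_finite[OF assms(2)] finite_subset by blast
  then show False by (simp add: infinite_Icc)
qed

text \<open>\<open>1 - z \<cdot> y = |y - z|\<^sup>2 / 2\<close>, a sum of squares of linear functions.\<close>

lemma integral_one_minus_inner:
  fixes z :: "real ^ 'n" and f :: "real ^ 'n \<Rightarrow> real"
  assumes "finite_measure M" and M: "sets M = sets (restrict_space borel (sphere 0 1))"
    and f: "continuous_on (sphere 0 1) f" and z: "z \<in> sphere 0 1"
  shows "(\<integral>y. (1 - z \<bullet> y) * (f y)\<^sup>2 \<partial>M) = (\<Sum>i\<in>UNIV. (\<integral>y. ((y $ i - z $ i) * f y)\<^sup>2 \<partial>M)) / 2"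
proof -
  have space: "space M = sphere 0 1"
    using sets_eq_imp_space_eq[OF M] by (simp add: space_restrict_space)
  have "(\<integral>y. (1 - z \<bullet> y) * (f y)\<^sup>2 \<partial>M) = (\<integral>y. (\<Sum>i\<in>UNIV. ((y $ i - z $ i) * f y)\<^sup>2) / 2 \<partial>M)"
  proof (rule Bochner_Integration.integral_cong)
    fix y assume "y \<in> space M"
    then have "z \<bullet> z = 1" "y \<bullet> y = 1"
      using z by (auto simp: space dot_square_norm)
    then have "(y - z) \<bullet> (y - z) = 2 * (1 - z \<bullet> y)"
      by (simp add: inner_diff_left inner_diff_right inner_commute)
    then have "(\<Sum>i\<in>UNIV. (y $ i - z $ i)\<^sup>2) = 2 * (1 - z \<bullet> y)"
      by (simp add: inner_vec_def power2_eq_square)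
    then show "(1 - z \<bullet> y) * (f y)\<^sup>2 = (\<Sum>i\<in>UNIV. ((y $ i - z $ i) * f y)\<^sup>2) / 2"
      by (simp add: power_mult_distrib sum_distrib_right[symmetric])
  qed simp
  also have "\<dots> = (\<Sum>i\<in>UNIV. (\<integral>y. ((y $ i - z $ i) * f y)\<^sup>2 \<partial>M)) / 2"
    by (subst Bochner_Integration.integral_divide_zero, subst Bochner_Integration.integral_sum)
      (auto intro!: integrable_on_sphere[OF assms(1) M] continuous_intros f)
  finally show ?thesis .
qed

theorem theorem7p2:
  fixes \<mu> :: "(real ^ 'n) measure"
    and d t :: nat and \<epsilon> a A R :: real and z :: "real ^ 'n"
  assumes dim: "CARD('n) = d + 1"
    and d1: "d \<ge> 1" and t1: "t \<ge> 1"
    and eps: "0 < \<epsilon>" "\<epsilon> < 1"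
    and aA: "0 < a" "a \<le> A"
    and sets_mu: "sets \<mu> = sets (restrict_space borel (sphere (0::real ^ 'n) 1))"
    and fin: "finite_measure \<mu>"
    and MZ: "\<And>f. f \<in> poly_space t \<Longrightarrow>
              a * (\<integral>x. (f x)\<^sup>2 \<partial>sphere_measure) \<le> (\<integral>x. (f x)\<^sup>2 \<partial>\<mu>) \<and>
              (\<integral>x. (f x)\<^sup>2 \<partial>\<mu>) \<le> A * (\<integral>x. (f x)\<^sup>2 \<partial>sphere_measure)"
    and R: "V_const d a A \<epsilon> / real t \<le> R" "R \<le> pi"
    and z: "z \<in> sphere 0 1"
  shows "measure \<mu> (cap z R) \<ge> a * \<epsilon> / real (dim_Pi d t)"
proof -
  interpret finite_measure \<mu> by fact
  note radius = radius_bounds[OF d1 t1 eps aA R]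
  have space: "space \<mu> = sphere 0 1"
    using sets_eq_imp_space_eq[OF sets_mu] by (simp add: space_restrict_space)
  \<comment> \<open>An arbitrary coordinate axis, used to express all integrals of functions of
    \<open>z . x\<close>.\<close>
  fix i :: 'n
  interpret pearson_functional "zonal_integral i" d
    by (rule pearson_functional_zonal_integral[OF dim d1])
  define P2 where "P2 = pderiv (pderiv (gegenbauer d t))"
  define q where "q = [:1, 1:] * P2"
  define f where "f x = poly q (z \<bullet> x)" for x
  define N where "N = real (dim_Pi d t)"
  define F where "F = (\<integral>x. (f x)\<^sup>2 \<partial>sphere_measure)"
  define E where "E = (\<integral>x. (1 - z \<bullet> x) * (f x)\<^sup>2 \<partial>sphere_measure)"
  have degP2: "degree P2 = t - 2"
    by (simp add: P2_def degree_pderiv degree_gegenbauer[OF d1])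
  have "P2 \<noteq> 0"
    using radius(2) degree_gegenbauer[OF d1, of t] by (auto simp: P2_def pderiv_eq_0_iff degree_pderiv)
  then have "q \<noteq> 0" by (simp add: q_def del: mult_pCons_left)
  have "degree q \<le> 1 + (t - 2)"
    unfolding q_def using degree_mult_le[of "[:1, 1:]" P2] by (simp add: degP2)
  then have deg: "degree q < t" using radius(2) by simp
  have cont: "continuous_on S f" for S
    unfolding f_def[abs_def] by (intro continuous_intros)
  have zonal: "(\<integral>x. poly p (z \<bullet> x) \<partial>sphere_measure) = zonal_integral i p" for p
    unfolding zonal_integral_def using z
    by (intro integral_sphere_measure_zonal continuous_intros) auto
  have F: "F = zonal_integral i (q\<^sup>2)"
    unfolding zonal[symmetric] by (simp add: F_def f_def)
  have E: "E = zonal_integral i ([:1, -1:] * q\<^sup>2)"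
    unfolding zonal[symmetric] by (simp add: E_def f_def algebra_simps del: mult_pCons_left)
  have Fpos: "F > 0"
    unfolding F using dim d1 by (intro zonal_integral_square_pos \<open>q \<noteq> 0\<close>) auto
  have sup: "(f x)\<^sup>2 \<le> N * F" if "x \<in> sphere 0 1" for x
    unfolding f_def N_def F_def using that deg by (intro zonal_poly_sup_bound dim) auto

  have Emu: "(\<integral>x. (1 - z \<bullet> x) * (f x)\<^sup>2 \<partial>\<mu>) \<le> A * E"
  proof -
    have "(\<integral>x. ((x $ j - z $ j) * f x)\<^sup>2 \<partial>\<mu>) \<le> A * (\<integral>x. ((x $ j - z $ j) * f x)\<^sup>2 \<partial>sphere_measure)" for j
      using MZ[OF coord_mult_zonal_poly_poly_space[OF deg, of j "z $ j" z]] by (simp add: f_def)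
    then have "(\<Sum>j\<in>UNIV. (\<integral>x. ((x $ j - z $ j) * f x)\<^sup>2 \<partial>\<mu>))
        \<le> A * (\<Sum>j\<in>UNIV. (\<integral>x. ((x $ j - z $ j) * f x)\<^sup>2 \<partial>sphere_measure))"
      unfolding sum_distrib_left by (intro sum_mono)
    then show ?thesis
      unfolding E_def integral_one_minus_inner[OF fin sets_mu cont z]
        integral_one_minus_inner[OF finite_measure_sphere_measure sets_sphere_measure cont z]
      by simp
  qed

  have cosR: "1 - cos R > 0"
    using radius(1) R(2) cos_monotone_0_pi[of 0 R] by simp
  have cap: "cap z R \<in> sets \<mu>"
  proof -
    have "cap z R = sphere 0 1 \<inter> {y. cos R \<le> z \<bullet> y}"
      by (auto simp: cap_def)
    moreover have "closed {y. cos R \<le> z \<bullet> y}"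
      by (intro closed_Collect_le continuous_intros)
    ultimately show ?thesis
      by (auto simp: sets_mu sets_restrict_space_sphere)
  qed
  have int_cap: "integrable \<mu> (\<lambda>x. N * F * indicator (cap z R) x)"
    using cap by (intro integrable_mult_right) (auto simp: less_top[symmetric])
  have int_out: "integrable \<mu> (\<lambda>x. (1 - z \<bullet> x) * (f x)\<^sup>2 / (1 - cos R))"
    using cosR by (intro integrable_on_sphere[OF fin sets_mu] continuous_intros cont) auto
  have "a * F \<le> (\<integral>x. (f x)\<^sup>2 \<partial>\<mu>)"
    using MZ[OF zonal_poly_poly_space[of q t z]] deg by (simp add: F_def f_def)
  \<comment> \<open>A Markov type bound: on the cap the sup bound \<open>N * F\<close> applies, and
    off the cap \<open>(1 - z . x) / (1 - cos R) >= 1\<close>.\<close>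
  also have "\<dots> \<le> (\<integral>x. N * F * indicator (cap z R) x + (1 - z \<bullet> x) * (f x)\<^sup>2 / (1 - cos R) \<partial>\<mu>)"
  proof (rule integral_mono)
    show "integrable \<mu> (\<lambda>x. (f x)\<^sup>2)"
      by (intro integrable_on_sphere[OF fin sets_mu] continuous_intros cont)
    show "integrable \<mu> (\<lambda>x. N * F * indicator (cap z R) x + (1 - z \<bullet> x) * (f x)\<^sup>2 / (1 - cos R))"
      by (intro Bochner_Integration.integrable_add int_cap int_out)
    fix x assume "x \<in> space \<mu>"
    then have x: "x \<in> sphere 0 1" by (simp add: space)
    have "z \<bullet> x \<le> 1"
      using norm_cauchy_schwarz[of z x] x z by simp
    then have nonneg: "(1 - z \<bullet> x) * (f x)\<^sup>2 / (1 - cos R) \<ge> 0"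
      using cosR by simp
    show "(f x)\<^sup>2 \<le> N * F * indicator (cap z R) x + (1 - z \<bullet> x) * (f x)\<^sup>2 / (1 - cos R)"
    proof (cases "x \<in> cap z R")
      case True
      then show ?thesis using sup[OF x] nonneg by simp
    next
      case False
      then have "1 - cos R \<le> 1 - z \<bullet> x"
        using x by (simp add: cap_def)
      then have "(1 - cos R) * (f x)\<^sup>2 \<le> (1 - z \<bullet> x) * (f x)\<^sup>2"
        by (intro mult_right_mono) auto
      then show ?thesis using False cosR by (simp add: field_simps)
    qed
  qed
  also have "\<dots> = N * F * measure \<mu> (cap z R) + (\<integral>x. (1 - z \<bullet> x) * (f x)\<^sup>2 \<partial>\<mu>) / (1 - cos R)"
    using cap by (subst Bochner_Integration.integral_add[OF int_cap int_out]) simp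
  also have "\<dots> \<le> N * F * measure \<mu> (cap z R) + A * E / (1 - cos R)"
    using Emu cosR by (intro add_left_mono divide_right_mono) auto
  also have "A * E / (1 - cos R) \<le> (1 - \<epsilon>) * a * F"
  proof -
    define D where "D = 4 * (real t * (real t + real d - 1)) + (real d)\<^sup>2 - 2 * real d"
    have DE: "D * E = real d * (real d + 4) * F"
      unfolding D_def E F using localized_polynomial[OF radius(2)] by (simp add: q_def P2_def)
    have D: "A * (real d * (real d + 4)) \<le> (1 - \<epsilon>) * a * (1 - cos R) * D"
      unfolding D_def by (rule radius(3))
    \<comment> \<open>Positivity of \<open>D\<close> is read off from inequality \<open>D\<close>,
      whose left side is positive.\<close>
    have "0 < A * (real d * (real d + 4))" using aA d1 by simp
    then have "0 < (1 - \<epsilon>) * a * (1 - cos R) * D" using D by linarith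
    then have Dpos: "D > 0" by (rule zero_less_mult_pos) (use eps aA cosR in simp)
    have "D * (A * E) = A * (real d * (real d + 4)) * F"
      using DE by (simp add: mult_ac)
    also have "\<dots> \<le> (1 - \<epsilon>) * a * (1 - cos R) * D * F"
      using D Fpos by (intro mult_right_mono) auto
    finally have "D * (A * E) \<le> D * ((1 - \<epsilon>) * a * F * (1 - cos R))"
      by (simp add: mult_ac)
    then show ?thesis
      using Dpos cosR by (simp add: pos_divide_le_eq)
  qed
  finally have "a * F \<le> N * F * measure \<mu> (cap z R) + (1 - \<epsilon>) * a * F" by simp
  then have "F * (a * \<epsilon>) \<le> F * (N * measure \<mu> (cap z R))"
    by (simp add: algebra_simps)
  then have "a * \<epsilon> \<le> N * measure \<mu> (cap z R)"
    using Fpos by simp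
  moreover have "N > 0"
    by (simp add: N_def dim_Pi_def add_pos_nonneg)
  ultimately show ?thesis
    by (simp add: N_def pos_divide_le_eq mult.commute)
qed

end
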